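(* Let $X$ be a compact metrizable space with a free interval $J$ and let $f:X\to X$ be a minimal (continuous) map. Then $X$ is a disjoint union of finitely many circles, $X=\bigoplus_{i=0}^{n-1}\mathbb{S}^1_i$, which are cyclically permuted by $f$ and, on each of them, $f^n$ is topologically conjugate to the same irrational rotation (of the circle).
   Context: A free interval of a topological space $X$ is an open subset of $X$ homeomorphic to an open interval of the real line. A continuous map $f:X\to X$ is minimal if the orbit $\{f^n(x): n\ge 0\}$ of every $x\in X$ is dense in $X$. A circle means a homeomorphic copy of the unit circle; $\bigoplus$ denotes topological disjoint union. *)

theory Defs
  imports "HOL-Analysis.Analysis"
begin

text \<open>Open intervals of the real line are taken to be nonempty; unbounded ones are allowed.\<close>

definition free_interval :: "'a topology \<Rightarrow> 'a set \<Rightarrow> bool" where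
  "free_interval X J \<longleftrightarrow> openin X J \<and>
     (\<exists>I :: real set. open I \<and> is_interval I \<and> I \<noteq> {} \<and>
        subtopology X J homeomorphic_space top_of_set I)"

definition forward_orbit :: "('a \<Rightarrow> 'a) \<Rightarrow> 'a \<Rightarrow> 'a set" where
  "forward_orbit f x = range (\<lambda>n. (f ^^ n) x)"

definition minimal_map :: "'a topology \<Rightarrow> ('a \<Rightarrow> 'a) \<Rightarrow> bool" where
  "minimal_map X f \<longleftrightarrow> continuous_map X X f \<and>
     (\<forall>x\<in>topspace X. X closure_of (forward_orbit f x) = topspace X)"

abbreviation unit_circle :: "complex topology" where
  "unit_circle \<equiv> top_of_set (sphere 0 1)"

definition is_circle :: "'a topology \<Rightarrow> bool" where
  "is_circle X \<longleftrightarrow> X homeomorphic_space unit_circle"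

text \<open>The canonical map from the external sum of the subspaces \<open>C i\<close> sends \<open>(i, x)\<close> to \<open>x\<close>.
  Its injectivity is disjointness of the pieces and its surjectivity is that they cover \<open>X\<close>.\<close>

definition is_disjoint_sum :: "'a topology \<Rightarrow> ('i \<Rightarrow> 'a set) \<Rightarrow> 'i set \<Rightarrow> bool" where
  "is_disjoint_sum X C I \<longleftrightarrow> (\<forall>i\<in>I. C i \<subseteq> topspace X) \<and>
     homeomorphic_map (sum_topology (\<lambda>i. subtopology X (C i)) I) X snd"

definition topologically_conjugate ::
    "'a topology \<Rightarrow> ('a \<Rightarrow> 'a) \<Rightarrow> 'b topology \<Rightarrow> ('b \<Rightarrow> 'b) \<Rightarrow> bool" where
  "topologically_conjugate X f Y g \<longleftrightarrow>
     continuous_map X X f \<and> continuous_map Y Y g \<and>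
     (\<exists>h. homeomorphic_map X Y h \<and> (\<forall>x\<in>topspace X. h (f x) = g (h x)))"

text \<open>Rotation by \<open>\<alpha>\<close> full turns; it is irrational when \<open>\<alpha>\<close> is.\<close>

definition rotation :: "real \<Rightarrow> complex \<Rightarrow> complex" where
  "rotation \<alpha> z = cis (2 * pi * \<alpha>) * z"

end

theory Submission
  imports Defs
begin

text \<open>A minimal map is irreducible: no proper closed set is mapped onto \<open>X\<close>, since the limit set of a
  backward orbit staying in a closed set is forward invariant. Hence an iterate that maps an interval
  of \<open>J\<close> back into \<open>J\<close> cannot fold it, so it is injective there. It follows that all iterates are open
  on \<open>J\<close>; as the iterates of \<open>J\<close> cover \<open>X\<close>, the map \<open>f\<close> is open, and by irreducibility injective, so it
  is a homeomorphism. Now choose \<open>p\<close> in \<open>J\<close> and an orientation preserving return \<open>f\<^sup>k p\<close> in \<open>J\<close>; the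
  arc from \<open>p\<close> to \<open>f\<^sup>k p\<close> and its images under \<open>f\<^sup>k, f\<^sup>2\<^sup>k, \<dots>\<close> fit together to an immersed line, which
  by recurrence meets itself. The first time it does so it closes up to an open circle \<open>C\<close>, and
  \<open>X\<close> is the finite union of the iterates of \<open>C\<close>. On \<open>C\<close> the first return map is a minimal circle
  homeomorphism; with \<open>F\<close> a lift and \<open>\<rho>\<close> its translation number, the supremum \<open>H\<close> of the values
  \<open>F\<^sup>n x - n \<rho>\<close>, \<open>n \<in> \<int>\<close>, conjugates it to the rotation by \<open>\<rho>\<close>.\<close>

section \<open>Lifts of minimal circle homeomorphisms\<close>

locale circle_lift =
  fixes F :: "real \<Rightarrow> real"
  assumes mono: "strict_mono F"
    and cont: "continuous_on UNIV F"
    and shift: "F (x + 1) = F x + 1"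
begin

lemma shift_int: "F (x + of_int m) = F x + of_int m"
proof (induction m rule: int_induct[where k = 0])
  case (step1 i)
  then show ?case using shift[of "x + of_int i"] by (simp add: add.assoc)
next
  case (step2 i)
  then show ?case using shift[of "x + of_int (i - 1)"] by simp
qed simp

lemma funpow_shift_int: "(F ^^ n) (x + of_int m) = (F ^^ n) x + of_int m"
  by (induction n) (simp_all add: shift_int)

lemma mono_funpow: "strict_mono (F ^^ n)"
proof (induction n)
  case (Suc n)
  then show ?case using mono by (simp add: strict_mono_def)
qed (simp add: strict_mono_def)

lemma cont_funpow: "continuous_on UNIV (F ^^ n)"
proof (induction n)
  case (Suc n)
  then show ?case
    unfolding funpow.simps using cont
    by (intro continuous_on_compose) (auto intro: continuous_on_subset)
qed simp

lemma funpow_surj: "\<exists>y. (F ^^ n) y = x"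
proof -
  define m where "m = \<lfloor>x - (F ^^ n) 0\<rfloor>"
  have *: "(F ^^ n) (0 + of_int m) \<le> x" "x \<le> (F ^^ n) (0 + of_int (m + 1))"
    unfolding funpow_shift_int m_def by linarith+
  have "\<exists>y\<ge>0 + of_int m. y \<le> 0 + of_int (m + 1) \<and> (F ^^ n) y = x"
    by (rule IVT') (use * cont_funpow in \<open>auto intro: continuous_on_subset\<close>)
  then show ?thesis by blast
qed

section \<open>Displacement of iterates and the translation number\<close>

lemma funpow_displacement: "\<bar>(F ^^ n) x - x - (F ^^ n) 0\<bar> \<le> 1"
proof -
  \<comment> \<open>On integers the displacement is exactly \<open>(F ^^ n) 0\<close>; monotonicity
    carries this over to \<open>x\<close> with an error of at most 1.\<close>
  define m where "m = \<lfloor>x\<rfloor>"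
  have "0 + of_int m \<le> x" "x \<le> 0 + of_int (m + 1)"
    unfolding m_def by linarith+
  then have "(F ^^ n) (0 + of_int m) \<le> (F ^^ n) x" "(F ^^ n) x \<le> (F ^^ n) (0 + of_int (m + 1))"
    using mono_funpow[of n] by (auto simp: strict_mono_less_eq simp del: add_0)
  then show ?thesis
    unfolding funpow_shift_int m_def by linarith
qed

text \<open>Each of the \<open>n\<close> blocks of \<open>m\<close> steps moves a point by
  \<open>(F ^^ m) 0\<close> up to 1, and the errors add up.\<close>

lemma funpow_mult_displacement: "\<bar>(F ^^ (n * m)) 0 - real n * (F ^^ m) 0\<bar> \<le> real n"
proof (induction n)
  case (Suc n)
  have "(F ^^ (Suc n * m)) 0 = (F ^^ m) ((F ^^ (n * m)) 0)"
    by (simp add: funpow_add)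
  moreover have "\<bar>(F ^^ m) ((F ^^ (n * m)) 0) - (F ^^ (n * m)) 0 - (F ^^ m) 0\<bar> \<le> 1"
    by (rule funpow_displacement)
  ultimately show ?case
    using Suc by (simp add: algebra_simps abs_le_iff)
qed simp

text \<open>The translation number of \<open>F\<close>, that is the limit of
  \<open>(F ^^ m) 0 / m\<close>, in the form of a supremum of lower estimates.\<close>

definition rho :: real where
  "rho = (SUP m\<in>{1..}. ((F ^^ m) 0 - 1) / real m)"

text \<open>Cutting \<open>m * k\<close> steps into blocks of length \<open>m\<close> or into blocks
  of length \<open>k\<close> shows that every lower estimate of the translation number is at most
  every upper estimate; \<open>rho\<close> separates the two families.\<close>

lemma rho_bounds:
  assumes "n \<ge> 1"
  shows "\<bar>(F ^^ n) 0 - real n * rho\<bar> \<le> 1"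
proof -
  have upper: "((F ^^ m) 0 - 1) / real m \<le> ((F ^^ k) 0 + 1) / real k"
    if "m \<ge> 1" "k \<ge> 1" for m k
  proof -
    have "real k * (F ^^ m) 0 - real k \<le> (F ^^ (k * m)) 0"
      "(F ^^ (m * k)) 0 \<le> real m * (F ^^ k) 0 + real m"
      using funpow_mult_displacement[of k m] funpow_mult_displacement[of m k] by linarith+
    then have "real k * ((F ^^ m) 0 - 1) \<le> real m * ((F ^^ k) 0 + 1)"
      by (simp add: algebra_simps)
    then show ?thesis
      using that by (simp add: field_simps)
  qed
  have "((F ^^ n) 0 - 1) / real n \<le> rho"
    unfolding rho_def using assms upper[of _ 1]
    by (intro cSUP_upper) (auto simp: bdd_above_def)
  moreover have "rho \<le> ((F ^^ n) 0 + 1) / real n"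
    unfolding rho_def by (rule cSUP_least) (use assms upper in auto)
  ultimately show ?thesis
    using assms by (simp add: field_simps abs_le_iff)
qed

lemma rho_displacement: "\<bar>(F ^^ n) x - x - real n * rho\<bar> \<le> 2"
  using rho_bounds[of n] funpow_displacement[of n x] by (cases "n = 0") auto

text \<open>All \<open>y - n \<rho> + m \<rho>\<close> with \<open>F\<^sup>m y = F\<^sup>n x\<close>: since \<open>n - m\<close> runs through all integers,
  the supremum satisfies \<open>H \<circ> F = H + \<rho>\<close> exactly.\<close>

definition shadow :: "real \<Rightarrow> real set" where
  "shadow x = {y - real n * rho + real m * rho | n m y. (F ^^ m) y = (F ^^ n) x}"

definition H :: "real \<Rightarrow> real" where
  "H x = Sup (shadow x)"

lemma self_in_shadow: "x \<in> shadow x"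
proof -
  have "x = x - real 0 * rho + real 0 * rho" "(F ^^ 0) x = (F ^^ 0) x"
    by simp_all
  then show ?thesis
    unfolding shadow_def by blast
qed

text \<open>The points \<open>y\<close> and \<open>x\<close> are carried to a common point in
  \<open>m\<close> and \<open>n\<close> steps, and each orbit deviates from uniform motion at speed
  \<open>rho\<close> by at most 2.\<close>

lemma shadow_le: "v \<in> shadow x \<Longrightarrow> v \<le> x + 4"
proof -
  assume "v \<in> shadow x"
  then obtain n m y where v: "v = y - real n * rho + real m * rho" "(F ^^ m) y = (F ^^ n) x"
    unfolding shadow_def by blast
  then show ?thesis
    using rho_displacement[of m y] rho_displacement[of n x] by linarith
qed

lemma bdd_shadow: "bdd_above (shadow x)"
  using shadow_le by (auto simp: bdd_above_def)

lemma H_translate: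
  assumes "\<And>v. v \<in> shadow x \<longleftrightarrow> v + c \<in> shadow y"
  shows "H y = H x + c"
proof -
  have "shadow y = (+) c ` shadow x"
  proof (intro set_eqI iffI)
    fix w assume "w \<in> shadow y"
    then have "w - c \<in> shadow x"
      using assms[of "w - c"] by simp
    then show "w \<in> (+) c ` shadow x"
      by (rule rev_image_eqI) simp
  qed (use assms in \<open>auto simp: add.commute\<close>)
  moreover have "Sup ((+) c ` shadow x) = c + Sup (shadow x)"
    using Sup_add_eq[of "\<lambda>v. v" "shadow x" c] bdd_shadow[of x] self_in_shadow[of x] by auto
  ultimately show ?thesis
    unfolding H_def by simp
qed

text \<open>Passing to \<open>F x\<close> is absorbed by one more step, in \<open>m\<close> for one
  direction and in \<open>n\<close> for the other, while \<open>y\<close> stays the same.\<close>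

lemma H_F: "H (F x) = H x + rho"
proof (rule H_translate)
  fix v
  show "v \<in> shadow x \<longleftrightarrow> v + rho \<in> shadow (F x)"
  proof
    assume "v \<in> shadow x"
    then obtain n m y where v: "v = y - real n * rho + real m * rho" "(F ^^ m) y = (F ^^ n) x"
      unfolding shadow_def by blast
    then have "v + rho = y - real n * rho + real (Suc m) * rho" "(F ^^ Suc m) y = (F ^^ n) (F x)"
      by (auto simp: algebra_simps funpow_swap1)
    then show "v + rho \<in> shadow (F x)"
      unfolding shadow_def by blast
  next
    assume "v + rho \<in> shadow (F x)"
    then obtain n m y where v: "v + rho = y - real n * rho + real m * rho" "(F ^^ m) y = (F ^^ n) (F x)"
      unfolding shadow_def by blast
    then have "v = y - real (Suc n) * rho + real m * rho" "(F ^^ m) y = (F ^^ Suc n) x"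
      by (auto simp: algebra_simps funpow_swap1)
    then show "v \<in> shadow x"
      unfolding shadow_def by blast
  qed
qed

lemma H_funpow: "H ((F ^^ n) x) = H x + real n * rho"
  by (induction n) (simp_all add: H_F algebra_simps)

lemma H_shift: "H (x + 1) = H x + 1"
proof (rule H_translate)
  fix v
  have sh: "(F ^^ k) (z + 1) = (F ^^ k) z + 1" for k z
    using funpow_shift_int[of k z 1] by simp
  show "v \<in> shadow x \<longleftrightarrow> v + 1 \<in> shadow (x + 1)"
  proof
    assume "v \<in> shadow x"
    then obtain n m y where v: "v = y - real n * rho + real m * rho" "(F ^^ m) y = (F ^^ n) x"
      unfolding shadow_def by blast
    then have "v + 1 = (y + 1) - real n * rho + real m * rho" "(F ^^ m) (y + 1) = (F ^^ n) (x + 1)"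
      by (auto simp: sh)
    then show "v + 1 \<in> shadow (x + 1)"
      unfolding shadow_def by blast
  next
    assume "v + 1 \<in> shadow (x + 1)"
    then obtain n m y where v: "v + 1 = y - real n * rho + real m * rho" "(F ^^ m) y = (F ^^ n) (x + 1)"
      unfolding shadow_def by blast
    then have "v = (y - 1) - real n * rho + real m * rho" "(F ^^ m) (y - 1) = (F ^^ n) x"
      using sh[of m "y - 1"] sh[of n x] by auto
    then show "v \<in> shadow x"
      unfolding shadow_def by blast
  qed
qed

lemma H_shift_int: "H (x + of_int m) = H x + of_int m"
proof (induction m rule: int_induct[where k = 0])
  case (step1 i)
  then show ?case using H_shift[of "x + of_int i"] by (simp add: add.assoc)
next
  case (step2 i)
  then show ?case using H_shift[of "x + of_int (i - 1)"] by simp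
qed simp

text \<open>Surjectivity of \<open>F ^^ m\<close> gives each \<open>y\<close> occurring in
  \<open>shadow x\<close> a partner \<open>y'\<close> for \<open>x'\<close>, and monotonicity of the
  iterates gives \<open>y \<le> y'\<close>.\<close>

lemma H_mono: "x \<le> x' \<Longrightarrow> H x \<le> H x'"
proof -
  assume le: "x \<le> x'"
  have "v \<le> H x'" if vx: "v \<in> shadow x" for v
  proof -
    obtain n m y where v: "v = y - real n * rho + real m * rho" "(F ^^ m) y = (F ^^ n) x"
      using vx by (auto simp: shadow_def)
    obtain y' where y': "(F ^^ m) y' = (F ^^ n) x'"
      using funpow_surj by blast
    have "(F ^^ m) y \<le> (F ^^ m) y'"
      using v y' le mono_funpow[of n] by (simp add: strict_mono_less_eq)
    then have "y \<le> y'"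
      using mono_funpow[of m] by (simp add: strict_mono_less_eq)
    moreover have "y' - real n * rho + real m * rho \<in> shadow x'"
      using y' unfolding shadow_def by blast
    then have "y' - real n * rho + real m * rho \<le> H x'"
      unfolding H_def by (rule cSup_upper[OF _ bdd_shadow])
    ultimately show ?thesis
      using v by linarith
  qed
  then show ?thesis
    unfolding H_def[of x] using self_in_shadow by (intro cSup_least) auto
qed

end

text \<open>\<open>dense\<close> is minimality of the induced circle map seen on the line: each
  orbit together with its integer translates is dense.\<close>

locale minimal_circle_lift = circle_lift +
  assumes dense: "a < b \<Longrightarrow> \<exists>n m. a < (F ^^ n) x + of_int m \<and> (F ^^ n) x + of_int m < b"
begin

text \<open>By equivariance and density, a jump of \<open>H\<close> at one point would be repeated, with the same
  height, in every interval.\<close>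

lemma H_small_oscillation:
  assumes "\<delta> > 0"
  shows "\<exists>s t. s < x \<and> x < t \<and> H t - H s < \<delta>"
proof (rule ccontr)
  assume "\<not> ?thesis"
  then have jump: "H t - H s \<ge> \<delta>" if "s < x" "x < t" for s t
    using that by force
  have all: "H t - H s \<ge> \<delta>" if st: "s < t" for s t
  proof -
    obtain n m where nm: "s < (F ^^ n) x + of_int m" "(F ^^ n) x + of_int m < t"
      using dense[OF st] by blast
    obtain s' t' where s': "(F ^^ n) s' = s - of_int m" and t': "(F ^^ n) t' = t - of_int m"
      using funpow_surj by meson
    have "(F ^^ n) s' < (F ^^ n) x" "(F ^^ n) x < (F ^^ n) t'"
      using nm s' t' by auto
    then have "s' < x" "x < t'"
      using mono_funpow[of n] by (simp_all add: strict_mono_less)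
    then have "H t' - H s' \<ge> \<delta>"
      by (rule jump)
    moreover have "H s = H s' + real n * rho + of_int m"
      using H_funpow[of n s'] H_shift_int[of "(F ^^ n) s'" m] s' by simp
    moreover have "H t = H t' + real n * rho + of_int m"
      using H_funpow[of n t'] H_shift_int[of "(F ^^ n) t'" m] t' by simp
    ultimately show ?thesis by simp
  qed
  \<comment> \<open>Cutting \<open>[0, 1]\<close> into \<open>N\<close> equal pieces, each raising
    \<open>H\<close> by at least \<open>\<delta>\<close>, exceeds the total rise
    \<open>H 1 - H 0 = 1\<close>.\<close>
  obtain N :: nat where N: "N > 0" "real N * \<delta> > 1"
    using reals_Archimedean3[OF assms] by (metis less_numeral_extra(1) mult_zero_left not_gr_zero of_nat_0 order_less_asym)
  have "H (real k / real N) \<ge> H 0 + real k * \<delta>" for k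
  proof (induction k)
    case (Suc k)
    have "H (real (Suc k) / real N) - H (real k / real N) \<ge> \<delta>"
      using N by (intro all) (simp add: divide_strict_right_mono)
    then show ?case using Suc by (simp add: algebra_simps)
  qed simp
  from this[of N] show False
    using N H_shift[of 0] by simp
qed

lemma H_cont: "continuous_on UNIV H"
proof -
  have "isCont H x" for x
    unfolding continuous_at_eps_delta
  proof (intro allI impI)
    fix e :: real assume "e > 0"
    then obtain s t where st: "s < x" "x < t" "H t - H s < e"
      using H_small_oscillation by blast
    show "\<exists>d>0. \<forall>x'. dist x' x < d \<longrightarrow> dist (H x') (H x) < e"
    proof (intro exI[of _ "min (x - s) (t - x)"] conjI allI impI)
      fix x' assume "dist x' x < min (x - s) (t - x)"
      then have "s \<le> x'" "x' \<le> t"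
        by (auto simp: dist_real_def)
      then show "dist (H x') (H x) < e"
        using st H_mono[of s x'] H_mono[of x' t] H_mono[of s x] H_mono[of x t]
        by (auto simp: dist_real_def)
    qed (use st in auto)
  qed
  then show ?thesis
    by (simp add: continuous_at_imp_continuous_on)
qed

text \<open>Density and equivariance would spread a plateau of \<open>H\<close> to every point, so
  that \<open>H\<close> would have derivative 0 everywhere, against
  \<open>H 1 = H 0 + 1\<close>.\<close>

lemma H_strict_mono: "strict_mono H"
proof (rule ccontr)
  assume "\<not> strict_mono H"
  then obtain x y where xy: "x < y" "\<not> H x < H y"
    by (auto simp: strict_mono_def)
  then have flat: "H z = H x" if "x \<le> z" "z \<le> y" for z
    using H_mono[of x z] H_mono[of z y] that by linarith
  have "(H has_field_derivative 0) (at z)" for z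
  proof -
    obtain n m where nm: "x < (F ^^ n) z + of_int m" "(F ^^ n) z + of_int m < y"
      using dense[OF xy(1)] by blast
    define U where "U = (\<lambda>w. (F ^^ n) w + of_int m) -` {x<..<y}"
    have "open U"
      unfolding U_def by (intro continuous_open_vimage)
        (use cont_funpow in \<open>auto simp: continuous_on_eq_continuous_at intro!: continuous_intros\<close>)
    moreover have "z \<in> U"
      using nm by (simp add: U_def)
    moreover have "H x - real n * rho - of_int m = H w" if "w \<in> U" for w
    proof -
      have "H ((F ^^ n) w + of_int m) = H x"
        using that by (intro flat) (auto simp: U_def)
      then show ?thesis
        unfolding H_shift_int H_funpow by linarith
    qed
    ultimately show ?thesis
      by (intro has_field_derivative_transform_within_open[OF DERIV_const]) auto
  qed
  then have "H 0 = H 1"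
    by (intro DERIV_isconst_all) blast
  then show False
    using H_shift[of 0] by simp
qed

text \<open>For \<open>rho = p / q\<close> the values of \<open>H\<close> on the integer translates
  of one orbit differ by multiples of \<open>1 / q\<close>, but density and continuity produce two
  distinct values closer than that.\<close>

lemma rho_irrational: "rho \<notin> \<rat>"
proof
  assume "rho \<in> \<rat>"
  then obtain p q :: int where q: "q > 0" "rho = of_int p / of_int q"
    by (meson Rats_cases')
  obtain t where t: "t > 0" "H t - H 0 < 1 / of_int q"
  proof -
    obtain s t where "s < 0" "0 < t" "H t - H s < 1 / of_int q"
      using H_small_oscillation[of "1 / of_int q" 0] q by auto
    then show ?thesis
      using that[of t] H_mono[of s 0] by simp
  qed
  obtain n m where nm: "0 < (F ^^ n) 0 + of_int m" "(F ^^ n) 0 + of_int m < t"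
    using dense[OF t(1)] by blast
  have "H 0 < H ((F ^^ n) 0 + of_int m)" "H ((F ^^ n) 0 + of_int m) < H t"
    using nm H_strict_mono by (auto simp: strict_mono_less)
  moreover have "H ((F ^^ n) 0 + of_int m) = H 0 + real n * rho + of_int m"
    by (simp add: H_funpow H_shift_int)
  ultimately have *: "0 < real n * rho + of_int m" "real n * rho + of_int m < 1 / of_int q"
    using t by linarith+
  have eq: "real n * rho + of_int m = of_int (int n * p + m * q) / of_int q"
    using q by (simp add: field_simps)
  have "0 < int n * p + m * q" "int n * p + m * q < 1"
    using * q unfolding eq by (simp_all add: divide_simps del: of_int_add of_int_mult)
  then show False by simp
qed

end

section \<open>Minimal circle homeomorphisms are conjugate to rotations\<close>

definition circ :: "real \<Rightarrow> complex" where
  "circ t = cis (2 * pi * t)"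

lemma circ_eq_iff: "circ s = circ t \<longleftrightarrow> (\<exists>m::int. s = t + of_int m)"
proof -
  have "circ s = circ t \<longleftrightarrow> (\<exists>m::int. 2 * pi * s = 2 * pi * t + 2 * of_int m * pi)"
    unfolding circ_def cis_conv_exp exp_eq by (simp add: complex_eq_iff algebra_simps)
  also have "\<dots> \<longleftrightarrow> (\<exists>m::int. s = t + of_int m)"
  proof (rule ex_cong1)
    fix m :: int
    have "2 * pi * s = 2 * pi * t + 2 * of_int m * pi \<longleftrightarrow> (2 * pi) * s = (2 * pi) * (t + of_int m)"
      by (simp add: algebra_simps)
    then show "2 * pi * s = 2 * pi * t + 2 * of_int m * pi \<longleftrightarrow> s = t + of_int m"
      by simp
  qed
  finally show ?thesis .
qed

lemma circ_add: "circ (s + t) = circ s * circ t"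
  by (simp add: circ_def cis_mult algebra_simps)

lemma circ_add_int [simp]: "circ (t + of_int m) = circ t"
  by (auto simp: circ_eq_iff)

lemma norm_circ [simp]: "norm (circ t) = 1"
  by (simp add: circ_def)

lemma cont_circ: "continuous_on S circ"
  unfolding circ_def by (intro continuous_intros)

lemma circ_surj:
  assumes "norm z = 1"
  obtains t where "0 \<le> t" "t < 1" "z = circ t"
proof
  show "z = circ (Arg2pi z / (2 * pi))"
    using Arg2pi_eq[of z] assms by (simp add: circ_def cis_conv_exp)
qed (use Arg2pi[of z] in auto)

lemma circ_image: "circ ` {0..1} = sphere 0 1"
proof
  show "sphere 0 1 \<subseteq> circ ` {0..1}"
    by (force elim: circ_surj)
qed auto

text \<open>The circle is \<open>[0, 1]\<close> with its endpoints glued, so \<open>Q\<close>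
  factors through \<open>circ\<close>; a continuous bijection from a compact space to a Hausdorff
  space is a homeomorphism.\<close>

lemma circle_homeomorphic_map:
  assumes cont: "continuous_map (top_of_set {0..1::real}) Y Q"
    and img: "Q ` {0..1} = topspace Y"
    and inj: "inj_on Q {0..<1}" and Q1: "Q 1 = Q 0"
    and Haus: "Hausdorff_space Y"
  obtains \<psi> where "homeomorphic_map unit_circle Y \<psi>" "\<And>t. t \<in> {0..1} \<Longrightarrow> \<psi> (circ t) = Q t"
proof -
  define \<psi> where "\<psi> z = Q (SOME t. t \<in> {0..1} \<and> circ t = z)" for z
  have \<psi>: "\<psi> (circ t) = Q t" if t: "t \<in> {0..1}" for t
  proof -
    define s where "s = (SOME s. s \<in> {0..1} \<and> circ s = circ t)"
    have s: "s \<in> {0..1} \<and> circ s = circ t"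
      unfolding s_def by (rule someI[of _ t]) (use t in auto)
    then obtain m :: int where m: "s = t + of_int m"
      by (auto simp: circ_eq_iff)
    then have "m < 2" "-2 < m"
      using s t by auto
    then have "m = -1 \<or> m = 0 \<or> m = 1"
      by presburger
    then have "s = t \<or> (s = 0 \<and> t = 1) \<or> (s = 1 \<and> t = 0)"
      using m s t by auto
    then show ?thesis
      unfolding \<psi>_def s_def[symmetric] using Q1 by auto
  qed
  have img': "\<psi> ` sphere 0 1 = topspace Y"
    unfolding circ_image[symmetric] img[symmetric] image_image
    by (rule image_cong) (simp_all add: \<psi>)
  have quot: "quotient_map (top_of_set {0..1}) unit_circle circ"
    by (rule continuous_imp_quotient_map)
      (auto simp: cont_circ circ_image compact_space_subtopology Hausdorff_space_subtopology
        simp del: image_subset_iff)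
  have "continuous_map unit_circle Y \<psi>"
    by (rule continuous_compose_quotient_map[OF quot])
      (rule continuous_map_eq[OF cont], simp add: \<psi>)
  moreover have "inj_on \<psi> (sphere 0 1)"
  proof (rule inj_onI)
    fix z w :: complex
    assume zw: "z \<in> sphere 0 1" "w \<in> sphere 0 1" "\<psi> z = \<psi> w"
    obtain s where s: "0 \<le> s" "s < 1" "z = circ s"
      using zw circ_surj[of z] by auto
    obtain t where t: "0 \<le> t" "t < 1" "w = circ t"
      using zw circ_surj[of w] by auto
    have "Q s = Q t"
      using zw s t \<psi> by auto
    then show "z = w"
      using inj_onD[OF inj, of s t] s t by auto
  qed
  ultimately have "homeomorphic_map unit_circle Y \<psi>"
    using img' Haus by (intro continuous_imp_homeomorphic_map) (auto simp: compact_space_subtopology)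
  then show ?thesis
    using \<psi> that by blast
qed

text \<open>The set is the open arc over \<open>{a<..<b}\<close>, described as the complement of the
  compact arc that completes the turn.\<close>

lemma circ_image_open:
  assumes "a < b" "b \<le> a + 1"
  shows "openin unit_circle (sphere 0 1 - circ ` {b..a + 1})"
proof -
  have "compact (circ ` {b..a + 1})"
    by (intro compact_continuous_image cont_circ) auto
  then have "closed (circ ` {b..a + 1})"
    by (rule compact_imp_closed)
  then show ?thesis
    by (simp add: openin_open Diff_eq open_Compl) blast
qed

section \<open>Lifting circle maps to the line\<close>

lemma circle_map_lift:
  assumes cont: "continuous_on (sphere 0 1) h" and img: "h ` sphere 0 1 \<subseteq> sphere 0 1"
  obtains F where "continuous_on UNIV F" "\<And>t. circ (F t) = h (circ t)"
proof -
  have "continuous_on UNIV (h \<circ> circ)"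
    by (intro continuous_on_compose cont_circ continuous_on_subset[OF cont]) auto
  moreover have "(h \<circ> circ) t \<noteq> 0" for t
  proof -
    have "h (circ t) \<in> sphere 0 1"
      using img by (auto simp: image_subset_iff)
    then show ?thesis by auto
  qed
  \<comment> \<open>The line is contractible, so the nowhere vanishing function
    \<open>h \<circ> circ\<close> has a continuous logarithm; its imaginary part divided by
    \<open>2 * pi\<close> is the lift.\<close>
  ultimately obtain g where g: "continuous_on UNIV g" "\<And>t. (h \<circ> circ) t = exp (g t)"
    by (metis UNIV_I contractible_UNIV continuous_logarithm_on_contractible)
  show ?thesis
  proof
    show "continuous_on UNIV (\<lambda>t. Im (g t) / (2 * pi))"
      by (intro continuous_intros g) simp
    fix t
    have "h (circ t) \<in> sphere 0 1"
      using img by (auto simp: image_subset_iff)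
    then have "norm (exp (g t)) = 1"
      using g(2)[of t] by simp
    then have "Re (g t) = 0"
      by simp
    then have "exp (g t) = cis (Im (g t))"
      by (simp add: exp_eq_polar)
    then show "circ (Im (g t) / (2 * pi)) = h (circ t)"
      using g(2)[of t] by (simp add: circ_def)
  qed
qed

text \<open>The increment over one turn is continuous and integer valued, hence constant;
  \<open>d\<close> is the degree of \<open>h\<close>.\<close>

lemma circle_lift_degree:
  assumes cont: "continuous_on UNIV F" and lift: "\<And>t. circ (F t) = h (circ t)"
  obtains d :: int where "\<And>t. F (t + 1) = F t + of_int d"
proof -
  have int: "F (t + 1) - F t \<in> \<int>" for t
  proof -
    have "circ (F (t + 1)) = circ (F t)"
      using circ_add_int[of t 1] lift by simp
    then show ?thesis
      by (auto simp: circ_eq_iff)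
  qed
  have "(\<lambda>t. F (t + 1) - F t) constant_on UNIV"
  proof (rule continuous_discrete_range_constant)
    show "continuous_on UNIV (\<lambda>t. F (t + 1) - F t)"
      by (intro continuous_intros continuous_on_compose2[OF cont] cont) auto
    fix x :: real
    have "1 \<le> norm ((F (y + 1) - F y) - (F (x + 1) - F x))"
      if "F (y + 1) - F y \<noteq> F (x + 1) - F x" for y
    proof -
      obtain k l :: int where "F (y + 1) - F y = of_int k" "F (x + 1) - F x = of_int l"
        using int by (meson Ints_cases)
      then show ?thesis
        using that by simp
    qed
    then show "\<exists>e>0. \<forall>y. y \<in> UNIV \<and> F (y + 1) - F y \<noteq> F (x + 1) - F x \<longrightarrow>
        e \<le> norm ((F (y + 1) - F y) - (F (x + 1) - F x))"
      by (intro exI[of _ 1]) auto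
  qed auto
  then obtain c where c: "\<And>t. F (t + 1) - F t = c"
    by (auto simp: constant_on_def)
  then obtain d :: int where "c = of_int d"
    using int by (metis Ints_cases)
  then show ?thesis
    using c that by (metis add.commute diff_add_cancel)
qed

text \<open>Injectivity leaves only the degrees 1 and -1, and a map of degree -1 has a fixed point.
  An injective lift is monotone, and degree 1 makes it increasing.\<close>

lemma circle_homeo_lift:
  assumes cont: "continuous_on UNIV F" and lift: "\<And>t. circ (F t) = h (circ t)"
    and inj: "inj_on h (sphere 0 1)"
    and nofix: "\<And>z. z \<in> sphere 0 1 \<Longrightarrow> h z \<noteq> z"
  shows "circle_lift F"
proof -
  have F_eq: "\<exists>m::int. s = t + of_int m" if "F s = F t + of_int k" for s t and k :: int
  proof -
    have "h (circ s) = h (circ t)"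
      using that by (metis circ_add_int lift)
    then have "circ s = circ t"
      using inj by (auto simp: inj_on_def)
    then show ?thesis
      by (simp add: circ_eq_iff)
  qed
  obtain d :: int where d: "\<And>t. F (t + 1) = F t + of_int d"
    using circle_lift_degree[OF cont lift] by blast
  have d0: "d \<noteq> 0"
  proof
    assume "d = 0"
    then have per: "F 1 = F 0"
      using d[of 0] by simp
    \<comment> \<open>In degree 0 the lift is a real function on the circle. Of its values at 0, 1/3
      and 2/3, if distinct, the middle one recurs on the arc between the other two points.\<close>
    have "\<exists>x y. 0 \<le> x \<and> x < y \<and> y < 1 \<and> F x = F y"
    proof (cases "F (1/3) = F 0 \<or> F (2/3) = F 0 \<or> F (1/3) = F (2/3)")
      case True
      then consider "F 0 = F (1/3)" | "F 0 = F (2/3)" | "F (1/3) = F (2/3)"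
        by auto
      then show ?thesis
      proof cases
        case 1 then show ?thesis by (intro exI[of _ 0] exI[of _ "1/3"]) auto
      next
        case 2 then show ?thesis by (intro exI[of _ 0] exI[of _ "2/3"]) auto
      next
        case 3 then show ?thesis by (intro exI[of _ "1/3"] exI[of _ "2/3"]) auto
      qed
    next
      case False
      have cont': "continuous_on S F" for S
        using cont continuous_on_subset by blast
      have ivt: "\<exists>x\<ge>a. x \<le> b \<and> F x = y"
        if "a \<le> b" "F a \<le> y \<and> y \<le> F b \<or> F b \<le> y \<and> y \<le> F a" for a b y
        using that IVT'[of F a y b] IVT2'[of F b y a] cont' by blast
      consider "F 0 < F (1/3) \<and> F (1/3) < F (2/3) \<or> F 0 > F (1/3) \<and> F (1/3) > F (2/3)"
        | "F 0 < F (2/3) \<and> F (2/3) < F (1/3) \<or> F 0 > F (2/3) \<and> F (2/3) > F (1/3)"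
        | "F (1/3) < F 0 \<and> F 0 < F (2/3) \<or> F (1/3) > F 0 \<and> F 0 > F (2/3)"
        using False by linarith
      then show ?thesis
      proof cases
        case 1
        then obtain x where x: "x \<ge> 2/3" "x \<le> 1" "F x = F (1/3)"
          using ivt[of "2/3" 1 "F (1/3)"] per by auto
        then have "x \<noteq> 1"
          using 1 per by auto
        then show ?thesis
          using x by (intro exI[of _ "1/3"] exI[of _ x]) auto
      next
        case 2
        then obtain x where x: "x \<ge> 0" "x \<le> 1/3" "F x = F (2/3)"
          using ivt[of 0 "1/3" "F (2/3)"] per by auto
        then show ?thesis
          by (intro exI[of _ x] exI[of _ "2/3"]) auto
      next
        case 3
        then obtain x where x: "x \<ge> 1/3" "x \<le> 2/3" "F x = F 0"
          using ivt[of "1/3" "2/3" "F 0"] per by auto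
        then show ?thesis
          by (intro exI[of _ 0] exI[of _ x]) auto
      qed
    qed
    then obtain x y where xy: "0 \<le> x" "x < y" "y < 1" "F y = F x"
      by auto
    then obtain m :: int where "y = x + of_int m"
      using F_eq[of y x 0] by auto
    then have "0 < m" "m < 1"
      using xy by auto
    then show False by simp
  qed
  have injF: "inj F"
  proof (rule injI)
    fix s t assume eq: "F s = F t"
    then obtain m :: int where m: "s = t + of_int m"
      using F_eq[of s t 0] by auto
    have "F (t + of_int m) = F t + of_int (d * m)" for m
    proof (induction m rule: int_induct[where k = 0])
      case (step1 i)
      then show ?case using d[of "t + of_int i"] by (simp add: algebra_simps)
    next
      case (step2 i)
      then show ?case using d[of "t + of_int (i - 1)"] by (simp add: algebra_simps)
    qed simp
    then show "s = t"
      using m eq d0 by auto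
  qed
  have dcases: "d = 1 \<or> d = -1"
  proof (rule ccontr)
    assume "\<not> ?thesis"
    then have "d \<ge> 2 \<or> d \<le> -2"
      using d0 by linarith
    \<comment> \<open>A lift that moves by more than one turn meets \<open>F 0 + 1\<close> or
      \<open>F 0 - 1\<close> strictly before 1, at a point that \<open>h \<circ> circ\<close>
      identifies with 0.\<close>
    then consider "F 0 + 1 < F 1" | "F 1 < F 0 - 1"
      using d[of 0] by fastforce
    then obtain x and k :: int where x: "0 \<le> x" "x \<le> 1" "F x = F 0 + of_int k" "k \<noteq> 0" "x \<noteq> 1"
    proof cases
      case 1
      then show ?thesis
        using IVT'[of F 0 "F 0 + 1" 1] cont continuous_on_subset that[of _ 1] by fastforce
    next
      case 2
      then show ?thesis
        using IVT2'[of F 1 "F 0 - 1" 0] cont continuous_on_subset that[of _ "-1"] by fastforce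
    qed
    then obtain m :: int where "x = of_int m"
      using F_eq[of x 0 k] by auto
    then have "0 \<le> m" "m < 1"
      using x by auto
    then have "x = 0"
      using \<open>x = of_int m\<close> by simp
    then show False
      using x by simp
  qed
  have "d \<noteq> -1"
  proof
    assume "d = -1"
    then have "F 1 = F 0 - 1"
      using d[of 0] by simp
    \<comment> \<open>Over \<open>[0, 1]\<close> the function \<open>F x - x\<close> goes from
      \<open>F 0\<close> to \<open>F 0 - 2\<close> and so takes this integer as a value.\<close>
    define k where "k = \<lfloor>F 0\<rfloor>"
    have "\<exists>x\<ge>0. x \<le> 1 \<and> F x - x = of_int k"
      by (rule IVT2')
        (use \<open>F 1 = F 0 - 1\<close> in \<open>auto simp: k_def intro!: continuous_intros continuous_on_subset[OF cont]\<close>,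
         linarith+)
    then obtain x where "F x = x + of_int k"
      by (auto simp: algebra_simps)
    then have "h (circ x) = circ x"
      by (metis circ_add_int lift)
    then show False
      using nofix[of "circ x"] by simp
  qed
  then have d1: "F (t + 1) = F t + 1" for t
    using dcases d by simp
  have "strict_mono F"
  proof -
    have "strict_mono_on UNIV F \<or> strict_antimono_on UNIV F"
      using injective_eq_monotone_map[of UNIV F] cont injF by auto
    moreover have "\<not> strict_antimono_on UNIV F"
      using d1[of 0] by (auto simp: monotone_on_def dest: spec[of _ 0] spec[of _ 1])
        (metis add.commute less_add_one not_less_iff_gr_or_eq zero_less_one)
    ultimately show ?thesis by blast
  qed
  then show ?thesis
    using cont d1 by unfold_locales
qed

text \<open>The function \<open>H\<close> of the lift commutes with integer shifts, so it descends
  to the circle, where it turns \<open>h\<close> into the rotation by \<open>rho\<close>.\<close>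

lemma minimal_circle_homeo_conjugate_rotation:
  assumes cont: "continuous_on (sphere 0 1) h" and img: "h ` sphere 0 1 \<subseteq> sphere 0 1"
    and inj: "inj_on h (sphere 0 1)"
    and dense: "\<And>z U. z \<in> sphere 0 1 \<Longrightarrow> openin unit_circle U \<Longrightarrow> U \<noteq> {} \<Longrightarrow> \<exists>n. (h ^^ n) z \<in> U"
  obtains \<alpha> \<Psi> where "\<alpha> \<notin> \<rat>" "homeomorphic_map unit_circle unit_circle \<Psi>"
    "\<And>z. z \<in> sphere 0 1 \<Longrightarrow> \<Psi> (h z) = rotation \<alpha> (\<Psi> z)"
proof -
  obtain F where F: "continuous_on UNIV F" "\<And>t. circ (F t) = h (circ t)"
    using circle_map_lift[OF cont img] by blast
  have nofix: "h z \<noteq> z" if z: "z \<in> sphere 0 1" for z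
  proof
    assume fx: "h z = z"
    have "(h ^^ n) z = z" for n
      by (induction n) (simp_all add: fx)
    moreover have "openin unit_circle (sphere 0 1 - {z})"
      by (simp add: openin_delete)
    moreover have "- z \<in> sphere 0 1 - {z}"
      using z by auto
    then have "sphere 0 1 - {z} \<noteq> {}"
      by blast
    ultimately show False
      using dense[OF z, of "sphere 0 1 - {z}"] by auto
  qed
  interpret circle_lift F
    by (rule circle_homeo_lift[OF F inj nofix])
  have Fn: "circ ((F ^^ n) x) = (h ^^ n) (circ x)" for n x
    by (induction n) (simp_all add: F)
  interpret minimal_circle_lift F
  proof
    fix a b x :: real
    assume ab: "a < b"
    \<comment> \<open>Shortened to at most one turn, so that the complementary arc is parametrised
      by \<open>{b'..a + 1}\<close>.\<close>
    define b' where "b' = min b (a + 1)"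
    have b': "a < b'" "b' \<le> a + 1" "b' \<le> b"
      using ab by (auto simp: b'_def)
    define U where "U = sphere 0 1 - circ ` {b'..a + 1}"
    have "circ ((a + b') / 2) \<in> U"
    proof -
      have False if t: "t \<in> {b'..a + 1}" "circ t = circ ((a + b') / 2)" for t
      proof -
        obtain m :: int where m: "t = (a + b') / 2 + of_int m"
          using t(2) by (auto simp: circ_eq_iff)
        then have "0 < real_of_int m" "real_of_int m < 1"
          using t(1) b' by (simp_all add: field_simps)
        then show False by simp
      qed
      then show ?thesis
        by (force simp: U_def)
    qed
    then have "U \<noteq> {}"
      by blast
    then obtain n where n: "(h ^^ n) (circ x) \<in> U"
      using dense[of "circ x" U] circ_image_open[OF b'(1,2)] unfolding U_def[symmetric] by auto
    \<comment> \<open>Brings the orbit point into the fundamental domain \<open>{a<..a + 1}\<close>,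
      where avoiding \<open>{b'..a + 1}\<close> means lying below \<open>b'\<close>.\<close>
    define m where "m = \<lfloor>a - (F ^^ n) x\<rfloor> + 1"
    have m: "a < (F ^^ n) x + of_int m" "(F ^^ n) x + of_int m \<le> a + 1"
      unfolding m_def by linarith+
    have "circ ((F ^^ n) x + of_int m) \<in> U"
      using n by (simp add: Fn)
    then have "(F ^^ n) x + of_int m \<notin> {b'..a + 1}"
      unfolding U_def by blast
    then have "(F ^^ n) x + of_int m < b"
      using m b' by auto
    then show "\<exists>n m. a < (F ^^ n) x + of_int m \<and> (F ^^ n) x + of_int m < b"
      using m by blast
  qed
  have H1: "H 1 = H 0 + 1"
    using H_shift[of 0] by simp
  obtain \<Psi> where \<Psi>: "homeomorphic_map unit_circle unit_circle \<Psi>"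
      "\<And>t. t \<in> {0..1} \<Longrightarrow> \<Psi> (circ t) = circ (H t)"
  proof (rule circle_homeomorphic_map[of unit_circle "\<lambda>t. circ (H t)"])
    have "continuous_on {0..1} (\<lambda>t. circ (H t))"
      by (rule continuous_on_compose2[OF cont_circ[of UNIV] continuous_on_subset[OF H_cont]]) auto
    then show "continuous_map (top_of_set {0..1}) unit_circle (\<lambda>t. circ (H t))"
      by auto
    show "(\<lambda>t. circ (H t)) ` {0..1} = topspace unit_circle"
    proof (intro equalityI subsetI)
      fix z assume "z \<in> topspace unit_circle"
      then obtain s where s: "z = circ s"
        using circ_surj[of z] by auto
      define m where "m = \<lfloor>s - H 0\<rfloor>"
      have "\<exists>t\<ge>0. t \<le> 1 \<and> H t = s + of_int (- m)"
        by (rule IVT') (use H1 continuous_on_subset[OF H_cont] in \<open>auto simp: m_def\<close>, linarith+)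
      then show "z \<in> (\<lambda>t. circ (H t)) ` {0..1}"
        using s circ_add_int[of s "-m"] by (metis (no_types, lifting) atLeastAtMost_iff image_iff)
    qed auto
    show "inj_on (\<lambda>t. circ (H t)) {0..<1}"
    proof (rule inj_onI)
      fix s t :: real
      assume st: "s \<in> {0..<1}" "t \<in> {0..<1}" "circ (H s) = circ (H t)"
      then obtain m :: int where m: "H s = H t + of_int m"
        by (auto simp: circ_eq_iff)
      have "H 0 \<le> H s" "H s < H 1" "H 0 \<le> H t" "H t < H 1"
        using st H_strict_mono by (auto simp: strict_mono_less strict_mono_less_eq)
      then have "real_of_int m < 1" "- 1 < real_of_int m"
        using m H1 by linarith+
      then have "m = 0"
        by simp
      then show "s = t"
        using m H_strict_mono by (simp add: strict_mono_eq)
    qed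
    show "circ (H 1) = circ (H 0)"
      using H1 circ_add_int[of "H 0" 1] by simp
  qed (auto simp: Hausdorff_space_subtopology)
  have \<Psi>': "\<Psi> (circ t) = circ (H t)" for t
  proof -
    have "circ t = circ (t + of_int (- \<lfloor>t\<rfloor>))" "circ (H (t + of_int (- \<lfloor>t\<rfloor>))) = circ (H t)"
      by (simp_all only: circ_add_int H_shift_int)
    moreover have "t + of_int (- \<lfloor>t\<rfloor>) \<in> {0..1}"
      by simp linarith
    ultimately show ?thesis
      using \<Psi>(2) by metis
  qed
  show ?thesis
  proof
    show "rho \<notin> \<rat>"
      by (rule rho_irrational)
    show "homeomorphic_map unit_circle unit_circle \<Psi>"
      by (rule \<Psi>)
    fix z :: complex assume "z \<in> sphere 0 1"
    then obtain t where "z = circ t"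
      using circ_surj[of z] by auto
    then show "\<Psi> (h z) = rotation rho (\<Psi> z)"
      unfolding rotation_def circ_def[symmetric] by (simp add: F(2)[symmetric] \<Psi>' H_F circ_add)
  qed
qed

section \<open>Minimal maps with a chart\<close>

text \<open>If \<open>u\<close> is constant on \<open>[s, t]\<close>, drop half of the interval; otherwise it has an interior
  extremum, and a small piece on one side of it is covered from the other side.\<close>

lemma interval_fold:
  fixes u :: "real \<Rightarrow> real"
  assumes "continuous_on {s..t} u" "s < t" "u s = u t"
  obtains U S where "open U" "U \<noteq> {}" "U \<subseteq> {s<..<t}" "S \<subseteq> {s..t}" "U \<inter> S = {}" "u ` U \<subseteq> u ` S"
proof -
  have max: "\<exists>U S. open U \<and> U \<noteq> {} \<and> U \<subseteq> {s<..<t} \<and> S \<subseteq> {s..t} \<and> U \<inter> S = {} \<and> v ` U \<subseteq> v ` S"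
    if v: "continuous_on {s..t} v" "v s = v t" and ex: "\<exists>r\<in>{s..t}. v r > v s" for v :: "real \<Rightarrow> real"
  proof -
    obtain c where c: "c \<in> {s..t}" "\<And>r. r \<in> {s..t} \<Longrightarrow> v r \<le> v c"
      using continuous_attains_sup[of "{s..t}" v] v assms by auto
    then have vc: "v c > v s"
      using ex by force
    then have sct: "s < c" "c < t"
      using c v by (auto simp: less_le)
    \<comment> \<open>Points left of the maximum with values above the common end value; the
      intermediate value theorem repeats these values on \<open>{c..t}\<close>.\<close>
    define U where "U = {s<..<c} \<inter> v -` {v s<..}"
    have "open U"
      unfolding U_def
      by (rule continuous_open_preimage) (use v sct in \<open>auto intro: continuous_on_subset\<close>)
    moreover have "U \<noteq> {}"
    proof -
      have "\<exists>x\<ge>s. x \<le> c \<and> v x = (v s + v c) / 2"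
        by (rule IVT') (use v vc sct in \<open>auto intro: continuous_on_subset\<close>)
      then obtain x where x: "s \<le> x" "x \<le> c" "v x = (v s + v c) / 2"
        by blast
      then have "x \<noteq> s" "x \<noteq> c" "v x > v s"
        using vc by auto
      then show ?thesis
        using x by (intro ex_in_conv[THEN iffD1] exI[of _ x]) (auto simp: U_def)
    qed
    moreover have "v ` U \<subseteq> v ` {c..t}"
    proof
      fix w assume "w \<in> v ` U"
      then have "v t \<le> w" "w \<le> v c"
        using c(2) sct v by (auto simp: U_def)
      then have "\<exists>x\<ge>c. x \<le> t \<and> v x = w"
        by (intro IVT2') (use v sct in \<open>auto intro: continuous_on_subset\<close>)
      then show "w \<in> v ` {c..t}"
        by auto
    qed
    ultimately show ?thesis
      using sct by (intro exI[of _ U] exI[of _ "{c..t}"]) (auto simp: U_def)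
  qed
  consider "\<exists>r\<in>{s..t}. u r > u s" | "\<exists>r\<in>{s..t}. u r < u s" | "\<forall>r\<in>{s..t}. u r = u s"
    by (meson linorder_neqE)
  then show ?thesis
  proof cases
    case 1
    from max[OF assms(1,3) this] show ?thesis
      using that by blast
  next
    case 2
    have "\<exists>U S. open U \<and> U \<noteq> {} \<and> U \<subseteq> {s<..<t} \<and> S \<subseteq> {s..t} \<and> U \<inter> S = {} \<and>
        (\<lambda>x. - u x) ` U \<subseteq> (\<lambda>x. - u x) ` S"
      by (rule max) (use 2 assms in \<open>auto intro!: continuous_on_minus\<close>)
    then obtain U S where US: "open U" "U \<noteq> {}" "U \<subseteq> {s<..<t}" "S \<subseteq> {s..t}" "U \<inter> S = {}"
        "(\<lambda>x. - u x) ` U \<subseteq> (\<lambda>x. - u x) ` S"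
      by blast
    then have "u ` U \<subseteq> u ` S"
      by (fastforce simp: image_iff)
    then show ?thesis
      using US that by blast
  next
    case 3
    then have *: "u r = u t" if "s \<le> r" "r \<le> t" for r
      using that assms(3) by (metis atLeastAtMost_iff)
    show ?thesis
    proof
      \<comment> \<open>On a constant piece the endpoint alone covers the image of the whole open
        interval.\<close>
      show "open {s<..<t}" "{s<..<t} \<noteq> {}" "{t} \<subseteq> {s..t}" "{s<..<t} \<inter> {t} = {}"
        using assms by auto
      have "u r \<in> u ` {t}" if "r \<in> {s<..<t}" for r
        using *[of r] that by simp
      then show "u ` {s<..<t} \<subseteq> u ` {t}"
        by blast
    qed auto
  qed
qed

section \<open>Minimality, surjectivity and irreducibility\<close>

locale minimal_system =
  fixes X :: "'a topology" and f :: "'a \<Rightarrow> 'a"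
  assumes comp: "compact_space X" and Haus: "Hausdorff_space X" and minimal: "minimal_map X f"
    and nonempty: "topspace X \<noteq> {}"
begin

lemma cont: "continuous_map X X f"
  using minimal by (simp add: minimal_map_def)

lemma cont_funpow: "continuous_map X X (f ^^ n)"
proof (induction n)
  case (Suc n)
  then show ?case
    unfolding funpow.simps using cont by (rule continuous_map_compose)
qed (simp add: id_def)

lemma funpow_in: "x \<in> topspace X \<Longrightarrow> (f ^^ n) x \<in> topspace X"
  using cont_funpow[of n] by (auto simp: continuous_map_def)

text \<open>Density is applied to the orbit of \<open>(f ^^ m) x\<close>, which makes the visit as
  late as desired.\<close>

lemma hits:
  assumes x: "x \<in> topspace X" and U: "openin X U" "U \<noteq> {}"
  obtains k where "k \<ge> m" "(f ^^ k) x \<in> U"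
proof -
  have "X closure_of (forward_orbit f ((f ^^ m) x)) = topspace X"
    using minimal funpow_in[OF x] by (simp add: minimal_map_def)
  moreover obtain y where "y \<in> U" "y \<in> topspace X"
    using U openin_subset[OF U(1)] by blast
  ultimately obtain z where "z \<in> forward_orbit f ((f ^^ m) x)" "z \<in> U"
    using U by (metis in_closure_of)
  then obtain n where "(f ^^ (n + m)) x \<in> U"
    by (auto simp: forward_orbit_def funpow_add)
  then show ?thesis
    using that[of "n + m"] by simp
qed

lemma closed_forward_invariant:
  assumes E: "closedin X E" "E \<noteq> {}" "f ` E \<subseteq> E"
  shows "E = topspace X"
proof (rule ccontr)
  assume "E \<noteq> topspace X"
  then have U: "openin X (topspace X - E)" "topspace X - E \<noteq> {}"
    using E(1) closedin_subset[OF E(1)] by (auto simp: openin_diff)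
  obtain x where x: "x \<in> E" "x \<in> topspace X"
    using E(2) closedin_subset[OF E(1)] by blast
  have "(f ^^ k) x \<in> E" for k
    by (induction k) (use x E in auto)
  then show False
    using hits[OF x(2) U, of 0] by auto
qed

text \<open>The limit set of a backward orbit inside \<open>F\<close> is forward invariant.\<close>

lemma closed_backward_invariant:
  assumes F: "closedin X F" "F \<noteq> {}" "F \<subseteq> f ` F"
  shows "F = topspace X"
proof -
  have "\<forall>x\<in>F. \<exists>y. y \<in> F \<and> f y = x"
    using F(3) by blast
  then obtain g where g: "\<And>x. x \<in> F \<Longrightarrow> g x \<in> F \<and> f (g x) = x"
    by metis
  obtain x0 where x0: "x0 \<in> F"
    using F by blast
  define y where "y n = (g ^^ n) x0" for n
  have yF: "y n \<in> F" for n
    unfolding y_def by (induction n) (use x0 g in auto)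
  have fy: "f (y (Suc n)) = y n" for n
    using g yF by (simp add: y_def)
  have FX: "F \<subseteq> topspace X"
    using closedin_subset[OF F(1)] .
  define K where "K m = X closure_of (y ` {m..})" for m
  have "(\<Inter>n. K n) \<noteq> {}"
  proof (rule compact_space_imp_nest[OF comp])
    show "closedin X (K n)" for n
      by (simp add: K_def)
    show "K n \<noteq> {}" for n
      using closure_of_subset[of "y ` {n..}" X] yF FX unfolding K_def by blast
    show "decseq K"
      unfolding K_def by (intro decseq_SucI closure_of_mono) auto
  qed
  moreover have "closedin X (\<Inter>n. K n)"
    by (rule closedin_Inter) (auto simp: K_def)
  moreover have "f ` (\<Inter>n. K n) \<subseteq> (\<Inter>n. K n)"
  proof clarify
    fix x n assume x: "x \<in> (\<Inter>n. K n)"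
    \<comment> \<open>Since \<open>f\<close> moves the sequence \<open>y\<close> back by one index,
      the tail from \<open>Suc n\<close> lands in the tail from \<open>n\<close>.\<close>
    have "f ` (K (Suc n)) \<subseteq> X closure_of (f ` y ` {Suc n..})"
      unfolding K_def by (rule continuous_map_image_closure_subset[OF cont])
    moreover have "f ` y ` {Suc n..} \<subseteq> y ` {n..}"
    proof clarify
      fix k assume "Suc n \<le> k"
      then obtain j where "k = Suc j" "n \<le> j"
        by (cases k) auto
      then show "f (y k) \<in> y ` {n..}"
        by (simp add: fy)
    qed
    ultimately show "f x \<in> K n"
      using x closure_of_mono[of "f ` y ` {Suc n..}" "y ` {n..}" X] unfolding K_def by blast
  qed
  ultimately have "(\<Inter>n. K n) = topspace X"
    by (intro closed_forward_invariant)
  moreover have "K 0 \<subseteq> F"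
    unfolding K_def using F yF by (intro closure_of_minimal) auto
  ultimately show ?thesis
    using FX by blast
qed

lemma closed_image: "closedin X E \<Longrightarrow> closedin X ((f ^^ k) ` E)"
  using continuous_imp_closed_map[OF cont_funpow comp Haus] by (simp add: closed_map_def)

lemma surj: "f ` topspace X = topspace X"
proof (rule closed_forward_invariant)
  show "closedin X (f ` topspace X)"
    using closed_image[of "topspace X" 1] by simp
  show "f ` f ` topspace X \<subseteq> f ` topspace X"
    using funpow_in[of _ 1] by auto
qed (use nonempty in auto)

lemma surj_funpow: "(f ^^ k) ` topspace X = topspace X"
proof (induction k)
  case (Suc k)
  have "(f ^^ Suc k) ` topspace X = f ` (f ^^ k) ` topspace X"
    by auto
  then show ?case using Suc surj by simp
qed simp

text \<open>The image of \<open>F\<close> under \<open>f ^^ k\<close> is closed and mapped by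
  \<open>f\<close> onto the space, so it is contained in its own image and is everything by
  \<open>closed_backward_invariant\<close>; this peels off one iterate.\<close>

lemma irreducible_closed:
  "closedin X F \<Longrightarrow> (f ^^ k) ` F = topspace X \<Longrightarrow> F = topspace X"
proof (induction k)
  case (Suc k)
  have "f ` ((f ^^ k) ` F) = topspace X"
    using Suc.prems(2) by (simp add: image_image)
  moreover have "(f ^^ k) ` F \<subseteq> topspace X"
    using Suc.prems closed_image closedin_subset by blast
  moreover have "(f ^^ k) ` F \<noteq> {}"
    using nonempty Suc.prems(2) by blast
  ultimately have "(f ^^ k) ` F = topspace X"
    using Suc.prems(1) by (intro closed_backward_invariant closed_image) simp_all
  then show ?case
    using Suc by simp
qed simp

text \<open>If \<open>S\<close> takes over all values of \<open>U\<close>, the closed complement of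
  \<open>U\<close> still maps onto the space, so nothing was removed. In this form irreducibility
  rules out folding.\<close>

lemma irreducible:
  assumes U: "openin X U" and S: "S \<subseteq> topspace X" "U \<inter> S = {}" and cover: "(f ^^ k) ` U \<subseteq> (f ^^ k) ` S"
  shows "U = {}"
proof -
  have "(f ^^ k) ` (topspace X - U) = topspace X"
  proof
    show "topspace X \<subseteq> (f ^^ k) ` (topspace X - U)"
    proof
      fix y assume "y \<in> topspace X"
      then obtain x where x: "x \<in> topspace X" "y = (f ^^ k) x"
        using surj_funpow[of k] by auto
      show "y \<in> (f ^^ k) ` (topspace X - U)"
      proof (cases "x \<in> U")
        case True
        then have "y \<in> (f ^^ k) ` S"
          using cover x by blast
        then show ?thesis
          using S by blast
      qed (use x in auto)
    qed
  qed (use funpow_in in auto)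
  then have "topspace X - U = topspace X"
    by (rule irreducible_closed[rotated]) (rule closedin_diff[OF closedin_topspace U])
  then show ?thesis
    using openin_subset[OF U] by blast
qed

end

section \<open>Consequences of a chart: \<open>f\<close> is a homeomorphism\<close>

locale minimal_system_chart = minimal_system +
  fixes e :: "real \<Rightarrow> 'a"
  assumes e_cont: "continuous_map euclideanreal X e"
    and e_open: "open_map euclideanreal X e"
    and e_inj: "inj e"
begin

lemma e_in: "e t \<in> topspace X"
  using e_cont by (auto simp: continuous_map_def)

lemma e_image_open: "open U \<Longrightarrow> openin X (e ` U)"
  using e_open by (simp add: open_map_def)

lemma inv_e_cont: "continuous_map (subtopology X (range e)) euclideanreal (inv e)"
proof -
  have "homeomorphic_map euclideanreal (subtopology X (range e)) e"
    using e_cont e_open e_inj e_in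
    by (intro bijective_open_imp_homeomorphic_map)
      (auto simp: continuous_map_in_subtopology open_map_into_subtopology topspace_subtopology)
  then obtain g where g: "homeomorphic_maps euclideanreal (subtopology X (range e)) e g"
    by (auto simp: homeomorphic_map_maps)
  then have ge: "g (e t) = t" for t
    by (simp add: homeomorphic_maps_def)
  have "continuous_map (subtopology X (range e)) euclideanreal g"
    using g by (simp add: homeomorphic_maps_def)
  then show ?thesis
    by (rule continuous_map_eq) (auto simp: ge inv_f_f[OF e_inj])
qed

lemma chart_map_cont:
  assumes "(f ^^ l) ` e ` K \<subseteq> range e"
  shows "continuous_on K (\<lambda>t. inv e ((f ^^ l) (e t)))"
proof -
  have "continuous_map (top_of_set K) X ((f ^^ l) \<circ> e)"
    by (intro continuous_map_compose[OF continuous_map_from_subtopology[OF e_cont] cont_funpow])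
  then have "continuous_map (top_of_set K) (subtopology X (range e)) ((f ^^ l) \<circ> e)"
    using assms by (auto simp: continuous_map_in_subtopology)
  from continuous_map_compose[OF this inv_e_cont] show ?thesis
    by (simp add: o_def)
qed

text \<open>By \<open>interval_fold\<close> a coincidence of two values would give an open piece of
  the chart whose image under \<open>f ^^ l\<close> is covered from a disjoint set, which
  \<open>irreducible\<close> forbids.\<close>

lemma chart_map_inj:
  assumes K: "is_interval K" and "(f ^^ l) ` e ` K \<subseteq> range e"
  shows "inj_on (\<lambda>t. inv e ((f ^^ l) (e t))) K"
proof (rule linorder_inj_onI', rule notI)
  define u where "u t = inv e ((f ^^ l) (e t))" for t
  have eu: "e (u t) = (f ^^ l) (e t)" if "t \<in> K" for t
  proof -
    have "(f ^^ l) (e t) \<in> range e"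
      using assms(2) that by blast
    then show ?thesis
      unfolding u_def by (rule f_inv_into_f)
  qed
  fix s t assume st: "s \<in> K" "t \<in> K" "s < t" "inv e ((f ^^ l) (e s)) = inv e ((f ^^ l) (e t))"
  have sub: "{s..t} \<subseteq> K"
    using K st(1,2) unfolding is_interval_1 by (meson atLeastAtMost_iff subsetI)
  have "continuous_on {s..t} u"
    using continuous_on_subset[OF chart_map_cont[OF assms(2)] sub] by (simp add: u_def[abs_def])
  moreover have "u s = u t"
    using st by (simp add: u_def)
  ultimately obtain U S where US: "open U" "U \<noteq> {}" "U \<subseteq> {s<..<t}" "S \<subseteq> {s..t}" "U \<inter> S = {}" "u ` U \<subseteq> u ` S"
    using interval_fold[of s t u] st by metis
  have "(f ^^ l) ` e ` U \<subseteq> (f ^^ l) ` e ` S"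
  proof clarify
    fix x assume x: "x \<in> U"
    then have "u x \<in> u ` S"
      using US(6) by blast
    then obtain y where y: "u x = u y" "y \<in> S"
      by (rule imageE)
    have "{s<..<t} \<subseteq> {s..t}"
      by auto
    then have "x \<in> K" "y \<in> K"
      using x y(2) US(3,4) sub by blast+
    then have "(f ^^ l) (e x) = (f ^^ l) (e y)"
      using eu[of x] eu[of y] y(1) by simp
    then show "(f ^^ l) (e x) \<in> (f ^^ l) ` e ` S"
      using y(2) by simp
  qed
  moreover have "e ` U \<inter> e ` S = {}"
    using US(5) e_inj by (simp flip: image_Int)
  moreover have "e ` S \<subseteq> topspace X"
    using e_in by blast
  ultimately have "e ` U = {}"
    using irreducible[OF e_image_open[OF US(1)]] by blast
  then show False
    using US(2) by blast
qed

text \<open>A point of \<open>f\<^sup>k J\<close> is carried back into \<open>J\<close> by some \<open>f\<^sup>l\<close>, \<open>l \<ge> k\<close>, which is open there;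
  irreducibility of \<open>f\<^sup>l\<^sup>-\<^sup>k\<close> then forces the compact arc \<open>f\<^sup>k A\<close> around this point to be a
  neighbourhood of it.\<close>

lemma chart_image_open:
  assumes "open U"
  shows "openin X ((f ^^ k) ` e ` U)"
proof (subst openin_subopen, clarify)
  fix t assume t: "t \<in> U"
  obtain l where l: "l \<ge> k" "(f ^^ l) (e t) \<in> range e"
    by (rule hits[OF e_in[of t] e_image_open[of UNIV], where m = k]) auto
  define V where "V = {s \<in> U. (f ^^ l) (e s) \<in> range e}"
  have "openin euclideanreal {s \<in> topspace euclideanreal. ((f ^^ l) \<circ> e) s \<in> range e}"
    by (rule openin_continuous_map_preimage[OF continuous_map_compose[OF e_cont cont_funpow]])
      (simp add: e_image_open)
  then have "open V"
    unfolding V_def using open_Int[OF assms] by (simp add: Collect_conj_eq)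
  then obtain d where d: "d > 0" "cball t d \<subseteq> V"
    using t l unfolding open_contains_cball V_def by blast
  \<comment> \<open>The open \<open>I\<close> serves for invariance of domain, the compact
    \<open>A\<close> for a closed image under \<open>f ^^ k\<close>.\<close>
  define I where "I = {t - d<..<t + d}"
  define A where "A = {t - d..t + d}"
  have IA: "I \<subseteq> A" and AV: "A \<subseteq> V" and tI: "t \<in> I" and I: "open I" "is_interval I"
    using d by (auto simp: I_def A_def cball_eq_atLeastAtMost is_interval_1)
  define u where "u s = inv e ((f ^^ l) (e s))" for s
  have sub: "(f ^^ l) ` e ` I \<subseteq> range e"
    using IA AV by (auto simp: V_def)
  have "open (u ` I)"
    unfolding u_def by (rule invariance_of_domain[OF chart_map_cont[OF sub] I(1) chart_map_inj[OF I(2) sub]])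
  moreover have "e ` u ` I = (f ^^ l) ` e ` I"
    unfolding image_image u_def
    by (rule image_cong[OF refl], rule f_inv_into_f) (use sub in blast)
  ultimately have opl: "openin X ((f ^^ l) ` e ` I)"
    using e_image_open by metis
  define W where "W = {w \<in> topspace X. (f ^^ (l - k)) w \<in> (f ^^ l) ` e ` I}"
  have W: "openin X W"
    unfolding W_def by (rule openin_continuous_map_preimage[OF cont_funpow opl])
  have fl: "(f ^^ l) x = (f ^^ (l - k)) ((f ^^ k) x)" for x
    using l by (metis comp_apply funpow_add le_add_diff_inverse2)
  have "compactin X (e ` A)"
    by (rule image_compactin[OF _ e_cont]) (simp add: A_def)
  then have "compactin X ((f ^^ k) ` e ` A)"
    by (rule image_compactin[OF _ cont_funpow])
  then have clA: "closedin X ((f ^^ k) ` e ` A)"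
    by (rule compactin_imp_closedin[OF Haus])
  have "W - (f ^^ k) ` e ` A = {}"
  proof (rule irreducible[of _ "(f ^^ k) ` e ` A" "l - k"])
    show "openin X (W - (f ^^ k) ` e ` A)"
      using W clA by (rule openin_diff)
    show "(f ^^ (l - k)) ` (W - (f ^^ k) ` e ` A) \<subseteq> (f ^^ (l - k)) ` (f ^^ k) ` e ` A"
      unfolding W_def using IA fl by auto
  qed (use closedin_subset[OF clA] in auto)
  moreover have "A \<subseteq> U"
    using AV by (auto simp: V_def)
  ultimately have "W \<subseteq> (f ^^ k) ` e ` U"
    by blast
  moreover have "(f ^^ k) (e t) \<in> W"
    using tI funpow_in e_in fl by (auto simp: W_def)
  ultimately show "\<exists>T. openin X T \<and> (f ^^ k) (e t) \<in> T \<and> T \<subseteq> (f ^^ k) ` e ` U"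
    using W by blast
qed

text \<open>The union of the iterates of the chart is open and forward invariant. Preimages of
  points outside it therefore stay outside, so its complement is closed and backward
  invariant.\<close>

lemma chart_iterates_cover:
  assumes "x \<in> topspace X"
  obtains k t where "x = (f ^^ k) (e t)"
proof -
  define M where "M = (\<Union>k. (f ^^ k) ` range e)"
  have "openin X M"
    unfolding M_def using chart_image_open[of UNIV] by auto
  then have "closedin X (topspace X - M)"
    by blast
  moreover have "topspace X - M \<subseteq> f ` (topspace X - M)"
  proof
    fix y assume y: "y \<in> topspace X - M"
    then obtain x where x: "x \<in> topspace X" "f x = y"
      using surj by (metis DiffD1 imageE)
    have "x \<notin> M"
    proof
      assume "x \<in> M"
      then obtain k t where "x = (f ^^ k) (e t)"
        by (auto simp: M_def)
      then have "y = (f ^^ Suc k) (e t)"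
        using x by simp
      then show False
        using y unfolding M_def by blast
    qed
    then show "y \<in> f ` (topspace X - M)"
      using x by blast
  qed
  moreover have "e 0 \<in> M"
    unfolding M_def by (rule UN_I[of 0]) auto
  then have "topspace X - M \<noteq> topspace X"
    using e_in by blast
  ultimately have "topspace X - M = {}"
    using closed_backward_invariant by blast
  then show ?thesis
    using assms that by (auto simp: M_def)
qed

text \<open>Near a point \<open>(f ^^ k) (e t)\<close> an open set is pulled back to the chart by
  \<open>f ^^ k\<close> and pushed forward by \<open>f ^^ Suc k\<close>, which is open on the
  chart.\<close>

lemma open_map: "open_map X X f"
  unfolding open_map_def
proof (intro allI impI, subst openin_subopen, clarify)
  fix U x assume U: "openin X U" "x \<in> U"
  then obtain k t where x: "x = (f ^^ k) (e t)"
    using chart_iterates_cover[of x] openin_subset[OF U(1)] by blast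
  define V where "V = {s \<in> topspace euclideanreal. ((f ^^ k) \<circ> e) s \<in> U}"
  have "openin euclideanreal V"
    unfolding V_def
    by (rule openin_continuous_map_preimage[OF continuous_map_compose[OF e_cont cont_funpow] U(1)])
  then have "openin X ((f ^^ Suc k) ` e ` V)"
    by (intro chart_image_open) simp
  moreover have "f x \<in> (f ^^ Suc k) ` e ` V"
    using U x by (auto simp: V_def)
  moreover have "(f ^^ Suc k) ` e ` V \<subseteq> f ` U"
    by (auto simp: V_def)
  ultimately show "\<exists>T. openin X T \<and> f x \<in> T \<and> T \<subseteq> f ` U"
    by blast
qed

text \<open>If two points had the same image, openness of \<open>f\<close> would let a neighbourhood
  of one cover the images of a whole neighbourhood of the other, against irreducibility.\<close>

lemma inj_f: "inj_on f (topspace X)"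
proof (rule inj_onI, rule ccontr)
  fix a b assume ab: "a \<in> topspace X" "b \<in> topspace X" "f a = f b" "a \<noteq> b"
  then obtain U V where UV: "openin X U" "openin X V" "a \<in> U" "b \<in> V" "disjnt U V"
    using Haus unfolding Hausdorff_space_def by blast
  define W where "W = U \<inter> {x \<in> topspace X. f x \<in> f ` V}"
  have "openin X {x \<in> topspace X. f x \<in> f ` V}"
    using UV open_map by (intro openin_continuous_map_preimage[OF cont]) (auto simp: open_map_def)
  then have "openin X W"
    unfolding W_def using UV by blast
  then have "W = {}"
  proof (rule irreducible)
    show "V \<subseteq> topspace X"
      using UV openin_subset by blast
    show "W \<inter> V = {}"
      using UV by (auto simp: W_def disjnt_def)
    show "(f ^^ 1) ` W \<subseteq> (f ^^ 1) ` V"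
      by (auto simp: W_def)
  qed
  moreover have "a \<in> W"
    unfolding W_def using ab UV by blast
  ultimately show False
    by blast
qed

lemma homeo: "homeomorphic_map X X f"
  by (rule bijective_open_imp_homeomorphic_map[OF cont open_map surj inj_f])

lemma homeo_funpow: "homeomorphic_map X X (f ^^ n)"
proof (induction n)
  case (Suc n)
  then show ?case
    unfolding funpow.simps using homeo by (rule homeomorphic_map_compose)
qed (simp only: funpow.simps homeomorphic_map_id)

end

section \<open>Immersed lines\<close>

text \<open>Let \<open>b\<close> be the first parameter at which \<open>\<gamma>\<close> meets itself on \<open>[0, \<infinity>)\<close>.  By openness it can only
  meet its starting point there, and it arrives from the side opposite to the one it left from.\<close>

lemma immersed_line_closes_up:
  assumes Haus: "Hausdorff_space X"
    and cont: "continuous_map euclideanreal X \<gamma>"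
    and op: "open_map euclideanreal X \<gamma>"
    and loc: "\<And>t. \<exists>d>0. inj_on \<gamma> {t - d<..<t + d}"
    and ninj: "\<not> inj_on \<gamma> {0..}"
  obtains b where "b > 0" "\<gamma> b = \<gamma> 0" "inj_on \<gamma> {0..<b}" "openin X (\<gamma> ` {0..b})"
proof -
  have opim: "openin X (\<gamma> ` U)" if "open U" for U
    using op that by (simp add: open_map_def)
  have pre: "open {t. \<gamma> t \<in> V}" if "openin X V" for V
    using openin_continuous_map_preimage[OF cont that] by simp
  have clo: "closedin X (\<gamma> ` {x..y})" for x y
    by (intro compactin_imp_closedin[OF Haus] image_compactin[OF _ cont]) simp
  have in_X: "\<gamma> t \<in> topspace X" for t
    using cont by (auto simp: continuous_map_def)
  define B where "B = {b. b > 0 \<and> inj_on \<gamma> {0..<b}}"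
  obtain s0 t0 where st0: "0 \<le> s0" "s0 < t0" "\<gamma> s0 = \<gamma> t0"
  proof -
    obtain x y where "x \<ge> 0" "y \<ge> 0" "\<gamma> x = \<gamma> y" "x \<noteq> y"
      using ninj by (auto simp: inj_on_def)
    then show ?thesis
      using that[of x y] that[of y x] by (metis linorder_neqE)
  qed
  have B_le: "b \<le> t0" if "b \<in> B" for b
  proof (rule ccontr)
    assume "\<not> b \<le> t0"
    then have "s0 = t0"
      using that st0 by (intro inj_onD[of \<gamma> "{0..<b}"]) (auto simp: B_def)
    then show False
      using st0 by simp
  qed
  then have bdd: "bdd_above B"
    by (auto simp: bdd_above_def)
  obtain d0 where d0: "d0 > 0" "inj_on \<gamma> {0 - d0<..<0 + d0}"
    using loc by blast
  have d0B: "d0 \<in> B"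
    using d0 by (auto simp: B_def intro: inj_on_subset)
  define b where "b = Sup B"
  have b_upper: "b' \<le> b" if "b' \<in> B" for b'
    unfolding b_def by (rule cSup_upper[OF that bdd])
  have b: "b > 0"
    using b_upper[OF d0B] d0 by linarith
  have inj: "inj_on \<gamma> {0..<b}"
  proof (rule inj_onI)
    fix x y assume xy: "x \<in> {0..<b}" "y \<in> {0..<b}" "\<gamma> x = \<gamma> y"
    have "max x y < Sup B"
      using xy by (simp add: b_def)
    then obtain b' where "b' \<in> B" "max x y < b'"
      using less_cSupE[of "max x y" B] d0B by blast
    then show "x = y"
      using xy by (intro inj_onD[of \<gamma> "{0..<b'}"]) (auto simp: B_def)
  qed
  \<comment> \<open>Otherwise injectivity would persist beyond \<open>b\<close>: the line keeps off
    the earlier arc because that arc is closed, and off its recent past by local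
    injectivity.\<close>
  have "\<exists>s. 0 \<le> s \<and> s < b \<and> \<gamma> s = \<gamma> b"
  proof (rule ccontr)
    assume no: "\<not> ?thesis"
    obtain d' where d': "d' > 0" "inj_on \<gamma> {b - d'<..<b + d'}"
      using loc by blast
    have "openin X (topspace X - \<gamma> ` {0..b - d'/2})"
      using clo by (simp add: openin_diff)
    then have "open {t. \<gamma> t \<in> topspace X - \<gamma> ` {0..b - d'/2}}"
      by (rule pre)
    moreover have "\<gamma> b \<in> topspace X - \<gamma> ` {0..b - d'/2}"
    proof -
      have "\<gamma> b \<notin> \<gamma> ` {0..b - d'/2}"
      proof
        assume "\<gamma> b \<in> \<gamma> ` {0..b - d'/2}"
        then obtain r where r: "\<gamma> b = \<gamma> r" "r \<in> {0..b - d'/2}"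
          by (rule imageE)
        then have "0 \<le> r" "r < b"
          using d' by auto
        then show False
          using no r(1)[symmetric] by blast
      qed
      then show ?thesis
        using in_X by simp
    qed
    ultimately obtain e where e: "e > 0" "\<And>t. dist t b < e \<Longrightarrow> \<gamma> t \<notin> \<gamma> ` {0..b - d'/2}"
      unfolding open_dist by blast
    define e' where "e' = min e (d'/2)"
    have e': "e' > 0" "e' \<le> e" "e' \<le> d'/2"
      using e d' by (auto simp: e'_def)
    have "inj_on \<gamma> {0..<b + e'}"
    proof (rule linorder_inj_onI', rule notI)
      fix x y assume xy: "x \<in> {0..<b + e'}" "y \<in> {0..<b + e'}" "x < y" "\<gamma> x = \<gamma> y"
      consider "y < b" | "y \<ge> b" "x \<le> b - d'/2" | "y \<ge> b" "x > b - d'/2"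
        by linarith
      then show False
      proof cases
        case 1
        then show ?thesis
          using inj_onD[OF inj xy(4)] xy(1,2,3) by auto
      next
        case 2
        have "dist y b < e"
          using 2 xy(2) e' by (auto simp: dist_real_def)
        moreover have "\<gamma> y \<in> \<gamma> ` {0..b - d'/2}"
          using 2 xy(1) unfolding xy(4)[symmetric] by auto
        ultimately show ?thesis
          using e by blast
      next
        case 3
        then show ?thesis
          using inj_onD[OF d'(2) xy(4)] xy(1,2,3) e' d'(1) by auto
      qed
    qed
    then have "b + e' \<in> B"
      using b e' by (simp add: B_def)
    then show False
      using b_upper e' by fastforce
  qed
  then obtain s where s: "0 \<le> s" "s < b" "\<gamma> s = \<gamma> b"
    by blast
  have near: "\<exists>t. b - \<delta> < t \<and> t < b \<and> \<gamma> t \<in> V" if V: "openin X V" "\<gamma> b \<in> V" and "\<delta> > 0" for V \<delta>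
  proof -
    obtain e where e: "e > 0" "\<And>t. dist t b < e \<Longrightarrow> \<gamma> t \<in> V"
      using pre[OF V(1)] V(2) unfolding open_dist by blast
    have "\<gamma> (b - min e \<delta> / 2) \<in> V"
      using e that by (intro e) (auto simp: dist_real_def)
    then show ?thesis
      using e that by (intro exI[of _ "b - min e \<delta> / 2"]) auto
  qed
  have "s = 0"
  proof (rule ccontr)
    assume "s \<noteq> 0"
    \<comment> \<open>Parameters within \<open>\<delta>\<close> of \<open>s\<close> are positive and
      smaller than those within \<open>(b - s) / 2\<close> of \<open>b\<close>, so a common value
      contradicts injectivity on \<open>{0..<b}\<close>.\<close>
    define \<delta> where "\<delta> = min s ((b - s) / 2)"
    have \<delta>: "\<delta> > 0" "\<delta> \<le> s" "\<delta> \<le> (b - s) / 2"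
      using s \<open>s \<noteq> 0\<close> by (auto simp: \<delta>_def min_def field_simps)
    have "\<gamma> b \<in> \<gamma> ` {s - \<delta><..<s + \<delta>}"
      unfolding s(3)[symmetric] using \<delta> by simp
    then obtain t where t: "b - (b - s) / 2 < t" "t < b" "\<gamma> t \<in> \<gamma> ` {s - \<delta><..<s + \<delta>}"
      using near[OF opim, of "{s - \<delta><..<s + \<delta>}" "(b - s) / 2"] s by auto
    then obtain r where r: "\<gamma> t = \<gamma> r" "r \<in> {s - \<delta><..<s + \<delta>}"
      by auto
    have "r < t" "0 \<le> r"
      using r(2) t(1) \<delta> by (simp_all add: field_simps)
    then show False
      using inj_onD[OF inj r(1)] t(2) by auto
  qed
  then have closed: "\<gamma> b = \<gamma> 0"
    using s by simp
  define d where "d = min d0 (b / 2)"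
  have "{- d<..<d} \<subseteq> {0 - d0<..<0 + d0}"
    by (auto simp: d_def)
  then have d: "d > 0" "d \<le> b / 2" "inj_on \<gamma> {- d<..<d}"
    using d0 b inj_on_subset[OF d0(2)] by (auto simp: d_def)
  have opd: "openin X (\<gamma> ` {- d<..<d})"
    by (simp add: opim)
  have "\<gamma> b \<in> \<gamma> ` {- d<..<d}"
    unfolding closed using d by simp
  then obtain \<eta>0 where \<eta>0: "\<eta>0 > 0" "\<And>t. dist t b < \<eta>0 \<Longrightarrow> \<gamma> t \<in> \<gamma> ` {- d<..<d}"
    using pre[OF opd] unfolding open_dist by blast
  define \<eta> where "\<eta> = min \<eta>0 d / 2"
  have \<eta>: "\<eta> > 0" "\<eta> < \<eta>0" "\<eta> < d"
    using \<eta>0 d by (auto simp: \<eta>_def)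
  define t1 where "t1 = b - \<eta>"
  have t1: "b / 2 < t1" "t1 < b"
    using \<eta> d by (auto simp: t1_def)
  \<comment> \<open>Just before \<open>b\<close> the line runs along the arc through
    \<open>\<gamma> 0\<close> on its negative side: a parameter \<open>r \<ge> 0\<close> there would
    repeat a point of \<open>{0..<b}\<close>.\<close>
  have arrive: "\<exists>r. - d < r \<and> r \<le> 0 \<and> (r = 0 \<longrightarrow> t = b) \<and> \<gamma> r = \<gamma> t" if "t1 \<le> t" "t \<le> b" for t
  proof -
    have "\<gamma> t \<in> \<gamma> ` {- d<..<d}"
      using that \<eta> by (intro \<eta>0) (auto simp: dist_real_def t1_def)
    then obtain r where r: "\<gamma> r = \<gamma> t" "r \<in> {- d<..<d}"
      by auto
    show ?thesis
    proof (cases "t = b")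
      case True
      then show ?thesis
        using closed d by (intro exI[of _ 0]) auto
    next
      case False
      have "r < 0"
      proof (rule ccontr)
        assume "\<not> r < 0"
        then have "r = t"
          using r(2) that False t1 d by (intro inj_onD[OF inj r(1)]) auto
        then show False
          using r(2) that t1 d by auto
      qed
      then show ?thesis
        using r by auto
    qed
  qed
  obtain r1 where r1: "- d < r1" "r1 < 0" "\<gamma> r1 = \<gamma> t1"
    using arrive[of t1] t1 by fastforce
  \<comment> \<open>The connected image of \<open>{t1..b}\<close> joins \<open>\<gamma> r1\<close>
    to \<open>\<gamma> 0\<close> inside the embedded arc over \<open>{- d<..<d}\<close>, so it
    cannot skip a point between them.\<close>
  have arc: "\<gamma> r \<in> \<gamma> ` {t1..b}" if r: "r1 \<le> r" "r \<le> 0" for r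
  proof (rule ccontr)
    assume no: "\<not> ?thesis"
    have "\<gamma> r1 \<in> \<gamma> ` {t1..b}" "\<gamma> 0 \<in> \<gamma> ` {t1..b}"
      unfolding r1(3) closed[symmetric] using t1 by simp_all
    then have "r \<noteq> r1" "r \<noteq> 0"
      using no by blast+
    then have r': "r1 < r" "r < 0"
      using r by auto
    define P where "P = {t. \<gamma> t \<in> \<gamma> ` {- d<..<r}}"
    define Q where "Q = {t. \<gamma> t \<in> \<gamma> ` {r<..<d}}"
    have "open P" "open Q"
      unfolding P_def Q_def by (simp_all add: pre opim)
    moreover have "{t1..b} \<subseteq> P \<union> Q"
    proof
      fix t assume t: "t \<in> {t1..b}"
      then obtain x where x: "- d < x" "x \<le> 0" "\<gamma> x = \<gamma> t"
        using arrive[of t] by auto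
      then have "x \<noteq> r"
        using no t by blast
      then have "x \<in> {- d<..<r} \<or> x \<in> {r<..<d}"
        using x(1,2) d(1) by auto
      then show "t \<in> P \<union> Q"
      proof
        assume "x \<in> {- d<..<r}"
        then have "\<gamma> x \<in> \<gamma> ` {- d<..<r}"
          by (rule imageI)
        then show ?thesis
          unfolding P_def x(3) by simp
      next
        assume "x \<in> {r<..<d}"
        then have "\<gamma> x \<in> \<gamma> ` {r<..<d}"
          by (rule imageI)
        then show ?thesis
          unfolding Q_def x(3) by simp
      qed
    qed
    moreover have "P \<inter> Q \<inter> {t1..b} = {}"
    proof -
      have False if t: "t \<in> P" "t \<in> Q" for t
      proof -
        obtain x y where xy: "\<gamma> t = \<gamma> x" "x \<in> {- d<..<r}" "\<gamma> t = \<gamma> y" "y \<in> {r<..<d}"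
          using t by (auto simp: P_def Q_def)
        have "\<gamma> x = \<gamma> y"
          using xy(1,3) by simp
        then have "x = y"
          by (rule inj_onD[OF d(3)]) (use xy(2,4) r' d(1) r1(1) in auto)
        then show False
          using xy(2,4) by simp
      qed
      then show ?thesis by blast
    qed
    moreover have "t1 \<in> P"
      unfolding P_def mem_Collect_eq r1(3)[symmetric] using r1(1) r' by simp
    moreover have "b \<in> Q"
      unfolding Q_def mem_Collect_eq closed using r' d(1) by simp
    ultimately show False
      using connectedD[OF connected_Icc[of t1 b], of P Q] t1 by auto
  qed
  \<comment> \<open>The loop is thereby also the image of an open interval, hence open.\<close>
  have "\<gamma> ` {0..b} = \<gamma> ` {r1<..<b}"
  proof
    show "\<gamma> ` {0..b} \<subseteq> \<gamma> ` {r1<..<b}"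
    proof clarify
      fix t assume "t \<in> {0..b}"
      then have "(if t = b then 0 else t) \<in> {r1<..<b}"
        using r1 b by auto
      moreover have "\<gamma> t = \<gamma> (if t = b then 0 else t)"
        using closed by simp
      ultimately show "\<gamma> t \<in> \<gamma> ` {r1<..<b}"
        by blast
    qed
    show "\<gamma> ` {r1<..<b} \<subseteq> \<gamma> ` {0..b}"
    proof clarify
      fix t assume t: "t \<in> {r1<..<b}"
      have "{t1..b} \<subseteq> {0..b}"
        using t1 b by auto
      then show "\<gamma> t \<in> \<gamma> ` {0..b}"
        using arc[of t] t by (cases "t \<le> 0") auto
    qed
  qed
  then have "openin X (\<gamma> ` {0..b})"
    using opim by simp
  then show ?thesis
    using that b closed inj by blast
qed

section \<open>Returns to the chart and their orientation\<close>

context minimal_system_chart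
begin

lemma forward_return:
  obtains q k where "k \<ge> 1" "p < q" "(f ^^ k) (e p) = e q"
  by (rule hits[OF e_in[of p] e_image_open[of "{p<..}"], where m = 1]) auto

text \<open>In the chart the return is a continuous injective function on an interval, hence
  strictly monotone; this gives it an orientation.\<close>

lemma local_chart_map:
  assumes "(f ^^ k) (e p) = e q"
  obtains d v where "d > 0" "continuous_on {p - d<..<p + d} v"
    "\<And>t. t \<in> {p - d<..<p + d} \<Longrightarrow> (f ^^ k) (e t) = e (v t)"
    "strict_mono_on {p - d<..<p + d} v \<or> strict_antimono_on {p - d<..<p + d} v"
proof -
  have "openin euclideanreal {s \<in> topspace euclideanreal. ((f ^^ k) \<circ> e) s \<in> range e}"
    by (rule openin_continuous_map_preimage[OF continuous_map_compose[OF e_cont cont_funpow]])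
      (simp add: e_image_open)
  moreover have "p \<in> {s \<in> topspace euclideanreal. ((f ^^ k) \<circ> e) s \<in> range e}"
    using assms by simp
  ultimately obtain d where d: "d > 0" "ball p d \<subseteq> {s. (f ^^ k) (e s) \<in> range e}"
    by (metis (mono_tags, lifting) comp_apply Collect_cong UNIV_I open_contains_ball open_openin topspace_euclidean)
  define I where "I = {p - d<..<p + d}"
  have sub: "(f ^^ k) ` e ` I \<subseteq> range e"
    using d(2) by (auto simp: I_def ball_eq_greaterThanLessThan)
  have int: "is_interval I"
    by (simp add: I_def is_interval_1)
  define v where "v t = inv e ((f ^^ k) (e t))" for t
  have "continuous_on I v" "inj_on v I"
    using chart_map_cont[OF sub] chart_map_inj[OF int sub] by (simp_all add: v_def[abs_def])
  moreover from this have "strict_mono_on I v \<or> strict_antimono_on I v"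
    using injective_eq_monotone_map[OF int] by blast
  moreover have "(f ^^ k) (e t) = e (v t)" if "t \<in> I" for t
  proof -
    have "(f ^^ k) (e t) \<in> range e"
      using sub that by blast
    then show ?thesis
      unfolding v_def by (rule f_inv_into_f[symmetric])
  qed
  ultimately show ?thesis
    using d that unfolding I_def by blast
qed

text \<open>If a first return reverses orientation, follow it by a second one: either that one preserves
  orientation, or the composition does.\<close>

lemma oriented_return:
  obtains p q k d v where "p < q" "k \<ge> 1" "(f ^^ k) (e p) = e q" "d > 0" "continuous_on {p - d<..<p + d} v"
    "strict_mono_on {p - d<..<p + d} v" "\<And>t. t \<in> {p - d<..<p + d} \<Longrightarrow> (f ^^ k) (e t) = e (v t)"
proof -
  obtain q k where k: "k \<ge> 1" "0 < q" "(f ^^ k) (e 0) = e q"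
    using forward_return by blast
  obtain d v where v: "d > 0" "continuous_on {0 - d<..<0 + d} v"
    "\<And>t. t \<in> {0 - d<..<0 + d} \<Longrightarrow> (f ^^ k) (e t) = e (v t)"
    "strict_mono_on {0 - d<..<0 + d} v \<or> strict_antimono_on {0 - d<..<0 + d} v"
    using local_chart_map[OF k(3)] by blast
  \<comment> \<open>This return starts at \<open>q\<close> and again moves to the right, so the
    composition of the two does as well.\<close>
  obtain r m where m: "m \<ge> 1" "q < r" "(f ^^ m) (e q) = e r"
    using forward_return by blast
  obtain c w where w: "c > 0" "continuous_on {q - c<..<q + c} w"
    "\<And>t. t \<in> {q - c<..<q + c} \<Longrightarrow> (f ^^ m) (e t) = e (w t)"
    "strict_mono_on {q - c<..<q + c} w \<or> strict_antimono_on {q - c<..<q + c} w"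
    using local_chart_map[OF m(3)] by blast
  consider "strict_mono_on {0 - d<..<0 + d} v" | "strict_mono_on {q - c<..<q + c} w"
    | "strict_antimono_on {0 - d<..<0 + d} v" "strict_antimono_on {q - c<..<q + c} w"
    using v w by blast
  then show ?thesis
  proof cases
    case 1
    then show ?thesis
      using that[OF k(2,1,3) v(1,2)] v(3) by blast
  next
    case 2
    then show ?thesis
      using that[OF m(2,1,3) w(1,2)] w(3) by blast
  next
    case 3
    have "e (v 0) = e q"
      using v(3)[of 0] v(1) k by simp
    then have v0: "v 0 = q"
      using e_inj by (simp add: inj_eq)
    have "open ({0 - d<..<0 + d} \<inter> v -` {q - c<..<q + c})"
      by (rule continuous_open_preimage[OF v(2)]) auto
    moreover have "0 \<in> {0 - d<..<0 + d} \<inter> v -` {q - c<..<q + c}"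
      using v0 v(1) w(1) by simp
    ultimately obtain a where a: "a > 0" "ball 0 a \<subseteq> {0 - d<..<0 + d} \<inter> v -` {q - c<..<q + c}"
      using open_contains_ball by blast
    define I where "I = {0 - a<..<0 + a}"
    have I: "I \<subseteq> {0 - d<..<0 + d}" "v ` I \<subseteq> {q - c<..<q + c}"
      using a(2) by (auto simp: I_def ball_eq_greaterThanLessThan)
    have cont: "continuous_on I (w \<circ> v)"
      using continuous_on_subset[OF v(2) I(1)] continuous_on_subset[OF w(2) I(2)]
      by (rule continuous_on_compose)
    have mono: "strict_mono_on I (w \<circ> v)"
    proof (rule strict_mono_onI)
      fix x y assume xy: "x \<in> I" "y \<in> I" "x < y"
      then have "v y < v x"
        using 3(1) I(1) by (auto simp: monotone_on_def)
      then show "(w \<circ> v) x < (w \<circ> v) y"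
        using 3(2) I(2) xy by (auto simp: monotone_on_def)
    qed
    have step: "(f ^^ (m + k)) (e t) = e ((w \<circ> v) t)" if "t \<in> I" for t
    proof -
      have "t \<in> {0 - d<..<0 + d}" "v t \<in> {q - c<..<q + c}"
        using I that by blast+
      then show ?thesis
        by (simp add: funpow_add v(3) w(3))
    qed
    show ?thesis
    proof (rule that[of 0 r "m + k" a "w \<circ> v"])
      show "(f ^^ (m + k)) (e 0) = e r"
        using k m by (simp add: funpow_add)
    qed (use k m a cont mono step in \<open>auto simp: I_def\<close>)
  qed
qed

end

section \<open>The line developed from an oriented return\<close>

locale oriented_return_chart = minimal_system_chart +
  fixes k :: nat and d :: real and v :: "real \<Rightarrow> real"
  assumes k_pos: "k \<ge> 1" and e01: "(f ^^ k) (e 0) = e 1" and d_pos: "d > 0"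
    and v_cont: "continuous_on {-d<..<d} v" and v_mono: "strict_mono_on {-d<..<d} v"
    and v_chart: "\<And>t. t \<in> {-d<..<d} \<Longrightarrow> (f ^^ k) (e t) = e (v t)"
begin

text \<open>The images of the arc \<open>e [0, 1]\<close> under \<open>f\<^sup>k, f\<^sup>2\<^sup>k, \<dots>\<close> fit together; below \<open>1\<close> the
  truncation in \<open>nat\<close> makes this the chart itself.\<close>

definition develop :: "real \<Rightarrow> 'a" where
  "develop t = (f ^^ (k * nat \<lfloor>t\<rfloor>)) (e (t - real (nat \<lfloor>t\<rfloor>)))"

lemma develop_chart: "t < 1 \<Longrightarrow> develop t = e t"
proof -
  assume "t < 1"
  then have "\<lfloor>t\<rfloor> \<le> 0"
    by linarith
  then have "nat \<lfloor>t\<rfloor> = 0"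
    by simp
  then show ?thesis
    by (simp add: develop_def)
qed

lemma develop_add_nat: "0 \<le> t \<Longrightarrow> develop (t + real n) = (f ^^ (k * n)) (develop t)"
proof -
  assume "0 \<le> t"
  then have "nat \<lfloor>t + real n\<rfloor> = n + nat \<lfloor>t\<rfloor>"
    by (simp add: nat_add_distrib)
  then show ?thesis
    by (simp add: develop_def distrib_left funpow_add)
qed

lemma develop_step: "1 \<le> t \<Longrightarrow> develop t = (f ^^ k) (develop (t - 1))"
  using develop_add_nat[of "t - 1" 1] by simp

text \<open>Bundles continuity, injectivity and openness near \<open>t\<close>, so that all three
  pass together from \<open>t\<close> to \<open>t + 1\<close>.\<close>

definition locally_embedded :: "real \<Rightarrow> bool" where
  "locally_embedded t \<longleftrightarrow> (\<exists>I. open I \<and> t \<in> I \<and> continuous_map (top_of_set I) X develop \<and>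
     inj_on develop I \<and> (\<forall>U. open U \<longrightarrow> U \<subseteq> I \<longrightarrow> openin X (develop ` U)))"

text \<open>Where the line reads in the chart as a continuous injective real function, openness is
  invariance of domain.\<close>

lemma locally_embedded_chart:
  assumes I: "open I" "t \<in> I" and w: "continuous_on I w" "inj_on w I"
    and eq: "\<And>s. s \<in> I \<Longrightarrow> develop s = e (w s)"
  shows "locally_embedded t"
  unfolding locally_embedded_def
proof (intro exI conjI allI impI)
  have "continuous_map (top_of_set I) X (e \<circ> w)"
    using w by (intro continuous_map_compose[OF _ e_cont]) simp
  then show "continuous_map (top_of_set I) X develop"
    by (rule continuous_map_eq) (simp add: eq)
  show "inj_on develop I"
  proof (rule inj_onI)
    fix x y assume xy: "x \<in> I" "y \<in> I" "develop x = develop y"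
    then have "w x = w y"
      using eq[of x] eq[of y] injD[OF e_inj] by metis
    then show "x = y"
      using xy w(2) by (auto dest: inj_onD)
  qed
  fix U assume U: "open U" "U \<subseteq> I"
  have "open (w ` U)"
    using continuous_on_subset[OF w(1) U(2)] U(1) inj_on_subset[OF w(2) U(2)]
    by (rule invariance_of_domain)
  moreover have "develop ` U = e ` w ` U"
    unfolding image_image using U(2) eq by (intro image_cong) auto
  ultimately show "openin X (develop ` U)"
    by (simp add: e_image_open)
qed (use I in auto)

lemma locally_embedded_less_1: "t < 1 \<Longrightarrow> locally_embedded t"
  by (rule locally_embedded_chart[of "{..<1}" t "\<lambda>s. s"]) (auto simp: develop_chart)

text \<open>At the junction the chart reads the identity on the left and \<open>v\<close> on the
  right. They agree because \<open>v 0 = 1\<close>, and since \<open>v\<close> is increasing the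
  line does not turn back.\<close>

lemma locally_embedded_1: "locally_embedded 1"
proof -
  \<comment> \<open>The bound 1 keeps \<open>s - 1\<close> below 1, where \<open>develop\<close> is
    the chart.\<close>
  define r where "r = min d 1"
  have r: "r > 0" "r \<le> d" "r \<le> 1"
    using d_pos by (auto simp: r_def)
  define I where "I = {1 - r<..<1 + r}"
  define w where "w s = (if s \<le> 1 then s else v (s - 1))" for s
  have "e (v 0) = e 1"
    using v_chart[of 0] d_pos e01 by simp
  then have v0: "v 0 = 1"
    using e_inj by (simp add: inj_eq)
  have shiftI: "s - 1 \<in> {-d<..<d}" if "s \<in> I" for s
    using that r by (auto simp: I_def)
  have "continuous_on I w"
    unfolding w_def
  proof (rule continuous_on_cases_le)
    show "continuous_on {t \<in> I. 1 \<le> t} (\<lambda>s. v (s - 1))"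
      by (rule continuous_on_compose2[OF v_cont]) (use shiftI in \<open>auto intro!: continuous_intros\<close>)
  qed (auto simp: v0 intro!: continuous_intros)
  moreover have "inj_on w I"
  proof (rule linorder_inj_onI')
    fix x y assume xy: "x \<in> I" "y \<in> I" "x < y"
    consider "y \<le> 1" | "x \<le> 1" "1 < y" | "1 < x"
      by linarith
    then have "w x < w y"
    proof cases
      case 2
      have "v 0 < v (y - 1)"
        using 2 shiftI[OF xy(2)] d_pos by (intro strict_mono_onD[OF v_mono]) auto
      then show ?thesis
        using 2 by (simp add: w_def v0)
    next
      case 3
      have "v (x - 1) < v (y - 1)"
        using shiftI xy by (intro strict_mono_onD[OF v_mono]) auto
      then show ?thesis
        using 3 xy by (simp add: w_def)
    qed (use xy in \<open>simp add: w_def\<close>)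
    then show "w x \<noteq> w y"
      by simp
  qed
  moreover have "develop s = e (w s)" if s: "s \<in> I" for s
  proof -
    consider "s < 1" | "s = 1" | "s > 1"
      by linarith
    then show ?thesis
    proof cases
      case 1
      then show ?thesis
        by (simp add: develop_chart w_def)
    next
      case 2
      then show ?thesis
        using develop_step[of 1] e01 by (simp add: develop_chart w_def)
    next
      case 3
      then show ?thesis
        using develop_step[of s] develop_chart[of "s - 1"] v_chart[OF shiftI[OF s]] s r
        by (simp add: w_def I_def)
    qed
  qed
  ultimately show ?thesis
    using r by (intro locally_embedded_chart[of I]) (auto simp: I_def)
qed

text \<open>Shifting the parameter by 1 amounts to applying \<open>f ^^ k\<close>, which is a
  homeomorphism.\<close>

lemma locally_embedded_step:
  assumes "locally_embedded t" "t > 0"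
  shows "locally_embedded (t + 1)"
proof -
  obtain I where I: "open I" "t \<in> I" "continuous_map (top_of_set I) X develop" "inj_on develop I"
    "\<And>U. open U \<Longrightarrow> U \<subseteq> I \<Longrightarrow> openin X (develop ` U)"
    using assms(1) unfolding locally_embedded_def by blast
  \<comment> \<open>Cut to positive parameters, so that \<open>develop_step\<close> applies after
    the shift.\<close>
  define I' where "I' = (+) 1 ` (I \<inter> {0<..})"
  have shift: "s - 1 \<in> I" "develop s = (f ^^ k) (develop (s - 1))" if "s \<in> I'" for s
    using that develop_step[of s] by (auto simp: I'_def)
  have in_X: "develop s \<in> topspace X" if "s \<in> I" for s
    using continuous_map_image_subset_topspace[OF I(3)] that by auto
  have "continuous_map (top_of_set I') (top_of_set I) (\<lambda>s. s - 1)"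
    using shift(1) by (auto intro!: continuous_intros)
  then have "continuous_map (top_of_set I') X ((f ^^ k) \<circ> (develop \<circ> (\<lambda>s. s - 1)))"
    by (intro continuous_map_compose[OF _ cont_funpow] continuous_map_compose[OF _ I(3)])
  then have 1: "continuous_map (top_of_set I') X develop"
    by (rule continuous_map_eq) (simp add: shift(2))
  have 2: "inj_on develop I'"
  proof (rule inj_onI)
    fix x y assume xy: "x \<in> I'" "y \<in> I'" "develop x = develop y"
    then have "(f ^^ k) (develop (x - 1)) = (f ^^ k) (develop (y - 1))"
      using shift(2) by metis
    then have "develop (x - 1) = develop (y - 1)"
      using homeomorphic_imp_injective_map[OF homeo_funpow[of k]] in_X shift(1) xy
      by (auto dest: inj_onD)
    then have "x - 1 = y - 1"
      using I(4) shift(1) xy by (auto dest: inj_onD)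
    then show "x = y" by simp
  qed
  have 3: "openin X (develop ` U)" if U: "open U" "U \<subseteq> I'" for U
  proof -
    have "open ((+) (- 1) ` U)"
      by (rule open_translation[OF U(1)])
    moreover have "(+) (- 1) ` U \<subseteq> I"
      using U(2) shift(1) by auto
    ultimately have "openin X (develop ` (+) (- 1) ` U)"
      by (rule I(5))
    then have "openin X ((f ^^ k) ` develop ` (+) (- 1) ` U)"
      using homeomorphic_imp_open_map[OF homeo_funpow[of k]] by (simp add: open_map_def)
    moreover have "(f ^^ k) ` develop ` (+) (- 1) ` U = develop ` U"
      unfolding image_image using U(2) shift(2) by (intro image_cong) auto
    ultimately show ?thesis by simp
  qed
  have "open I'"
    unfolding I'_def by (intro open_translation open_Int I(1)) simp
  moreover have "t + 1 \<in> I'"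
    using I(2) assms(2) by (auto simp: I'_def)
  ultimately show ?thesis
    unfolding locally_embedded_def using 1 2 3 by blast
qed

lemma develop_locally_embedded: "locally_embedded t"
proof -
  have "locally_embedded t" if "t \<le> real n" for n t
    using that
  proof (induction n arbitrary: t)
    case (Suc n)
    consider "t < 1" | "t = 1" | "t > 1"
      by linarith
    then show ?case
    proof cases
      case 3
      then show ?thesis
        using locally_embedded_step[of "t - 1"] Suc by simp
    qed (use locally_embedded_less_1 locally_embedded_1 in auto)
  qed (simp add: locally_embedded_less_1)
  then show ?thesis
    using real_arch_simple by blast
qed

lemma develop_cont: "continuous_map euclideanreal X develop"
  unfolding continuous_map_def
proof (intro conjI allI impI)
  show "develop \<in> topspace euclideanreal \<rightarrow> topspace X"
    by (auto simp: develop_def intro!: funpow_in e_in)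
  fix V assume V: "openin X V"
  show "openin euclideanreal {t \<in> topspace euclideanreal. develop t \<in> V}"
  proof (subst openin_subopen, clarify)
    fix t assume t: "develop t \<in> V"
    obtain I where I: "open I" "t \<in> I" "continuous_map (top_of_set I) X develop"
      using develop_locally_embedded[of t] unfolding locally_embedded_def by blast
    have "openin (top_of_set I) {s \<in> topspace (top_of_set I). develop s \<in> V}"
      by (rule openin_continuous_map_preimage[OF I(3) V])
    then have "open {s \<in> I. develop s \<in> V}"
      using openin_open_trans[OF _ I(1)] by simp
    then show "\<exists>T. openin euclideanreal T \<and> t \<in> T \<and> T \<subseteq> {t \<in> topspace euclideanreal. develop t \<in> V}"
      using I t by (intro exI[of _ "{s \<in> I. develop s \<in> V}"]) auto
  qed
qed

lemma develop_open: "open_map euclideanreal X develop"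
  unfolding open_map_def
proof (intro allI impI, subst openin_subopen, clarify)
  fix U t assume U: "openin euclideanreal U" "t \<in> U"
  obtain I where I: "open I" "t \<in> I" "\<forall>U. open U \<longrightarrow> U \<subseteq> I \<longrightarrow> openin X (develop ` U)"
    using develop_locally_embedded[of t] unfolding locally_embedded_def by (elim exE conjE)
  have "open (U \<inter> I)"
    using U(1) I(1) by (simp add: open_Int)
  then have "openin X (develop ` (U \<inter> I))"
    using I(3) by simp
  then show "\<exists>T. openin X T \<and> develop t \<in> T \<and> T \<subseteq> develop ` U"
    using U(2) I(2) by (intro exI[of _ "develop ` (U \<inter> I)"]) auto
qed

lemma develop_locally_injective: "\<exists>d>0. inj_on develop {t - d<..<t + d}"
proof -
  obtain I where I: "open I" "t \<in> I" "inj_on develop I"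
    using develop_locally_embedded[of t] unfolding locally_embedded_def by blast
  then obtain r where r: "r > 0" "ball t r \<subseteq> I"
    using open_contains_ball by blast
  have "inj_on develop {t - r<..<t + r}"
    using inj_on_subset[OF I(3) r(2)] by (simp add: ball_eq_greaterThanLessThan)
  then show ?thesis
    using r(1) by blast
qed

text \<open>Among infinitely many visits of one orbit to the arc, two are congruent modulo \<open>k\<close>.\<close>

lemma develop_not_injective: "\<not> inj_on develop {0..}"
proof
  assume inj: "inj_on develop {0..}"
  define V where "V = e ` {0<..<1}"
  define N where "N = {j. (f ^^ j) (e 0) \<in> V}"
  have V: "openin X V" "V \<noteq> {}"
    by (simp_all add: V_def e_image_open)
  have "infinite N"
    unfolding infinite_nat_iff_unbounded_le
  proof
    fix m
    obtain j where "j \<ge> m" "(f ^^ j) (e 0) \<in> V"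
      using hits[OF e_in V] by blast
    then show "\<exists>n\<ge>m. n \<in> N"
      by (auto simp: N_def)
  qed
  moreover have "(\<lambda>j. j mod k) ` N \<subseteq> {..<k}"
    using k_pos by auto
  then have "finite ((\<lambda>j. j mod k) ` N)"
    by (rule finite_subset) simp
  ultimately have "\<not> inj_on (\<lambda>j. j mod k) N"
    using finite_imageD by blast
  then obtain i j where ij: "i \<in> N" "j \<in> N" "i mod k = j mod k" "i < j"
    by (metis inj_onI linorder_neqE_nat)
  have "k dvd j - i"
    using ij(3,4) by (metis mod_eq_dvd_iff_nat less_imp_le)
  then obtain n where n: "j - i = k * n"
    by (auto simp: dvd_def)
  then have n1: "n \<ge> 1"
    using ij(4) by (cases n) auto
  obtain s where s: "s \<in> {0<..<1}" "(f ^^ i) (e 0) = e s"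
    using ij(1) by (auto simp: N_def V_def)
  obtain s' where s': "s' \<in> {0<..<1}" "(f ^^ j) (e 0) = e s'"
    using ij(2) by (auto simp: N_def V_def)
  have "(f ^^ j) (e 0) = (f ^^ (k * n)) ((f ^^ i) (e 0))"
    using ij(4) n by (metis comp_apply funpow_add le_add_diff_inverse2 less_imp_le)
  then have "(f ^^ (k * n)) (e s) = e s'"
    using s(2) s'(2) by simp
  \<comment> \<open>\<open>f ^^ (k * n)\<close> acts on the line as translation by \<open>n\<close>,
    whereas both \<open>s\<close> and \<open>s'\<close> lie in the unit interval.\<close>
  then have "develop (s + real n) = develop s'"
    using develop_add_nat[of s n] s(1) s'(1) by (simp add: develop_chart)
  then have "s + real n = s'"
    using s(1) s'(1) by (intro inj_onD[OF inj]) auto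
  then show False
    using s(1) s'(1) n1 by simp
qed

text \<open>The arc up to the first closing parameter \<open>b\<close> is an open set; being a
  compact connected image it is also closed and connected, and rescaling \<open>{0..b}\<close>
  parametrises it as a circle.\<close>

lemma circle_component:
  obtains C \<psi> where "openin X C" "closedin X C" "connectedin X C"
    "homeomorphic_map unit_circle (subtopology X C) \<psi>"
proof -
  obtain b where b: "b > 0" "develop b = develop 0" "inj_on develop {0..<b}"
      "openin X (develop ` {0..b})"
    using immersed_line_closes_up[OF Haus develop_cont develop_open develop_locally_injective
        develop_not_injective] by blast
  define C where "C = develop ` {0..b}"
  have C: "openin X C" "closedin X C" "connectedin X C" "C \<subseteq> topspace X"
    using b(4) openin_subset[OF b(4)]
    by (auto simp: C_def intro!: compactin_imp_closedin[OF Haus] image_compactin[OF _ develop_cont]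
        connectedin_continuous_map_image[OF develop_cont])
  have img: "(\<lambda>t. b * t) ` {0..1} = {0..b}"
    using b(1) by (simp add: image_mult_atLeastAtMost)
  obtain \<psi> where "homeomorphic_map unit_circle (subtopology X C) \<psi>"
  proof (rule circle_homeomorphic_map[of "subtopology X C" "\<lambda>t. develop (b * t)"])
    have "continuous_map (top_of_set {0..1}) euclideanreal (\<lambda>t. b * t)"
      by (auto intro!: continuous_intros)
    from continuous_map_compose[OF this develop_cont]
    have "continuous_map (top_of_set {0..1}) X (\<lambda>t. develop (b * t))"
      by (simp add: o_def)
    moreover have "(\<lambda>t. develop (b * t)) ` {0..1} = C"
      unfolding C_def img[symmetric] by (simp add: image_image)
    ultimately show "continuous_map (top_of_set {0..1}) (subtopology X C) (\<lambda>t. develop (b * t))"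
      and "(\<lambda>t. develop (b * t)) ` {0..1} = topspace (subtopology X C)"
      using C(4) by (auto simp: continuous_map_in_subtopology)
    show "inj_on (\<lambda>t. develop (b * t)) {0..<1}"
    proof (rule inj_onI)
      fix x y assume xy: "x \<in> {0..<1}" "y \<in> {0..<1}" "develop (b * x) = develop (b * y)"
      then have "b * x = b * y"
        using b(1) by (intro inj_onD[OF b(3)]) auto
      then show "x = y"
        using b(1) by simp
    qed
  qed (use b Haus in \<open>auto simp: Hausdorff_space_subtopology\<close>)
  then show ?thesis
    using C that by blast
qed

end

section \<open>Decomposition into circles\<close>

text \<open>On each summand \<open>snd\<close> is the inclusion of an open set; the covering and
  disjointness make it bijective.\<close>

lemma is_disjoint_sum_clopen:
  assumes op: "\<And>i. i \<in> I \<Longrightarrow> openin X (C i)" and un: "(\<Union>i\<in>I. C i) = topspace X"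
    and disj: "\<And>i j. i \<in> I \<Longrightarrow> j \<in> I \<Longrightarrow> i \<noteq> j \<Longrightarrow> C i \<inter> C j = {}"
  shows "is_disjoint_sum X C I"
  unfolding is_disjoint_sum_def
proof (intro conjI ballI)
  show sub: "C i \<subseteq> topspace X" if "i \<in> I" for i
    using openin_subset[OF op[OF that]] .
  let ?S = "sum_topology (\<lambda>i. subtopology X (C i)) I"
  have top: "topspace ?S = Sigma I C"
    using sub by (auto simp: o_def)
  show "homeomorphic_map ?S X snd"
  proof (rule bijective_open_imp_homeomorphic_map)
    show "continuous_map ?S X snd"
      unfolding continuous_map_def
    proof (intro conjI allI impI)
      show "snd \<in> topspace ?S \<rightarrow> topspace X"
        using subsetD[OF sub] unfolding top by auto
      fix U assume U: "openin X U"
      show "openin ?S {x \<in> topspace ?S. snd x \<in> U}"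
        unfolding openin_sum_topology
      proof (intro conjI ballI)
        fix i assume i: "i \<in> I"
        have "{x. (i, x) \<in> {x \<in> topspace ?S. snd x \<in> U}} = U \<inter> C i"
          using i unfolding top by auto
        then show "openin (subtopology X (C i)) {x. (i, x) \<in> {x \<in> topspace ?S. snd x \<in> U}}"
          using U by (simp add: openin_subtopology_Int)
      qed (auto simp: o_def)
    qed
    show "open_map ?S X snd"
      unfolding open_map_def
    proof (intro allI impI)
      fix U assume U: "openin ?S U"
      then have "U \<subseteq> Sigma I C"
        using openin_subset top by blast
      then have "snd ` U = (\<Union>i\<in>I. {x. (i, x) \<in> U})"
        by force
      moreover have "openin X {x. (i, x) \<in> U}" if "i \<in> I" for i
        using U op[OF that] that openin_trans_full unfolding openin_sum_topology by blast
      ultimately show "openin X (snd ` U)"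
        by auto
    qed
    show "snd ` topspace ?S = topspace X"
      unfolding top un[symmetric] by force
    show "inj_on snd (topspace ?S)"
      unfolding top inj_on_def using disj by fastforce
  qed
qed

context minimal_system_chart
begin

text \<open>An affine change of parameter moves \<open>p\<close> to 0 and \<open>q\<close> to 1, the
  normalisation in which the line is developed.\<close>

lemma clopen_circle:
  obtains C \<psi> where "openin X C" "closedin X C" "connectedin X C"
    "homeomorphic_map unit_circle (subtopology X C) \<psi>"
proof -
  obtain p q k d v where r: "p < q" "k \<ge> 1" "(f ^^ k) (e p) = e q" "d > 0"
    and v: "continuous_on {p - d<..<p + d} v" "strict_mono_on {p - d<..<p + d} v"
      "\<And>t. t \<in> {p - d<..<p + d} \<Longrightarrow> (f ^^ k) (e t) = e (v t)"
    using oriented_return by blast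
  define c where "c = q - p"
  have c: "c > 0" "p + c = q"
    using r(1) by (simp_all add: c_def)
  define A where "A s = p + c * s" for s
  define d' where "d' = d / c"
  define v' where "v' s = (v (A s) - p) / c" for s
  have A: "A s \<in> {p - d<..<p + d}" if "s \<in> {-d'<..<d'}" for s
    using that c by (auto simp: A_def d'_def field_simps)
  have A_cont: "continuous_on S A" for S
    unfolding A_def by (intro continuous_intros)
  have Av: "A (v' s) = v (A s)" for s
    using c by (simp add: A_def v'_def)
  have A_map: "continuous_map euclideanreal euclideanreal A"
    using A_cont[of UNIV] by (simp only: continuous_map_iff_continuous2)
  have cont: "continuous_map euclideanreal X (\<lambda>s. e (A s))"
    using continuous_map_compose[OF A_map e_cont] by (simp only: o_def)
  have open_m: "open_map euclideanreal X (\<lambda>s. e (A s))"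
    unfolding open_map_def
  proof (intro allI impI)
    fix U :: "real set" assume "openin euclideanreal U"
    then have "open U"
      by (simp only: open_openin)
    then have "open ((\<lambda>s. p + c *\<^sub>R s) ` U)"
      using c(1) by (intro open_affinity) simp_all
    then have "openin X (e ` A ` U)"
      unfolding A_def[abs_def] real_scaleR_def by (rule e_image_open)
    then show "openin X ((\<lambda>s. e (A s)) ` U)"
      by (simp only: image_image)
  qed
  have inj: "inj (\<lambda>s. e (A s))"
  proof (rule injI)
    fix s t assume "e (A s) = e (A t)"
    then have "A s = A t"
      by (rule injD[OF e_inj])
    then show "s = t"
      using c(1) by (simp add: A_def)
  qed
  have ends: "(f ^^ k) (e (A 0)) = e (A 1)"
    using r(3) c(2) by (simp add: A_def)
  have d': "d' > 0"
    using r(4) c(1) by (simp add: d'_def)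
  have "continuous_on {-d'<..<d'} (\<lambda>s. v (A s))"
    by (rule continuous_on_compose2[OF v(1) A_cont]) (use A in blast)
  then have v'_cont: "continuous_on {-d'<..<d'} v'"
    unfolding v'_def[abs_def] using c(1) by (intro continuous_on_divide continuous_on_diff continuous_on_const) auto
  have v'_mono: "strict_mono_on {-d'<..<d'} v'"
  proof (rule strict_mono_onI)
    fix x y assume xy: "x \<in> {-d'<..<d'}" "y \<in> {-d'<..<d'}" "x < y"
    have "A x < A y"
      using xy(3) c(1) by (simp add: A_def)
    then have "v (A x) < v (A y)"
      by (rule strict_mono_onD[OF v(2) A[OF xy(1)] A[OF xy(2)]])
    then show "v' x < v' y"
      using c(1) by (simp add: v'_def divide_strict_right_mono)
  qed
  have chart: "(f ^^ k) (e (A t)) = e (A (v' t))" if "t \<in> {-d'<..<d'}" for t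
    unfolding Av by (rule v(3)[OF A[OF that]])
  interpret R: oriented_return_chart X f "\<lambda>s. e (A s)" k d' v'
    by unfold_locales (fact cont open_m inj r(2) ends d' v'_cont v'_mono chart)+
  show ?thesis
    using R.circle_component that by blast
qed

text \<open>Connected clopen sets that meet coincide, so \<open>C\<close> returns to itself at the
  first time \<open>n\<close> at which an iterate meets it. The union of the iterates up to then is
  closed and forward invariant.\<close>

lemma circle_cycle:
  assumes C: "openin X C" "closedin X C" "connectedin X C" "C \<noteq> {}"
  obtains n where "n > 0" "(f ^^ n) ` C = C" "(\<Union>i<n. (f ^^ i) ` C) = topspace X"
    "\<And>i j. i < n \<Longrightarrow> j < n \<Longrightarrow> i \<noteq> j \<Longrightarrow> (f ^^ i) ` C \<inter> (f ^^ j) ` C = {}"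
proof -
  have CX: "C \<subseteq> topspace X"
    using openin_subset[OF C(1)] .
  obtain x where x: "x \<in> C" "x \<in> topspace X"
    using C(4) CX by blast
  define P where "P n \<longleftrightarrow> n \<ge> 1 \<and> (f ^^ n) ` C \<inter> C \<noteq> {}" for n
  have "\<exists>n. P n"
  proof -
    obtain m where "m \<ge> 1" "(f ^^ m) x \<in> C"
      using hits[OF x(2) C(1,4)] by blast
    then show ?thesis
      using x(1) unfolding P_def by blast
  qed
  then obtain n where n: "P n" "\<And>i. i < n \<Longrightarrow> \<not> P i"
    using exists_least_iff[of P] by blast
  have n1: "n \<ge> 1"
    using n(1) by (simp add: P_def)
  have inj: "inj_on (f ^^ i) (topspace X)" for i
    using homeomorphic_imp_injective_map[OF homeo_funpow] .
  have op: "openin X ((f ^^ i) ` C)" for i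
    using homeomorphic_imp_open_map[OF homeo_funpow[of i]] C(1) by (simp add: open_map_def)
  have clo: "closedin X ((f ^^ i) ` C)" for i
    by (rule closed_image[OF C(2)])
  have conn: "connectedin X ((f ^^ i) ` C)" for i
    by (rule connectedin_continuous_map_image[OF cont_funpow C(3)])
  have eq: "S = T" if "connectedin X S" "connectedin X T" "openin X S" "closedin X S" "openin X T" "closedin X T"
    "S \<inter> T \<noteq> {}" for S T
  proof -
    have "S \<subseteq> T" if "connectedin X S" "openin X T" "closedin X T" "S \<inter> T \<noteq> {}" for S T
      using connectedin_clopen_cases[OF that(1,3,2)] that(4) unfolding disjnt_def by blast
    then show ?thesis
      using that by (metis Int_commute subset_antisym)
  qed
  have return: "(f ^^ n) ` C = C"
    using n(1) conn[of n] op[of n] clo[of n] C unfolding P_def by (intro eq) auto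
  have disj: "(f ^^ i) ` C \<inter> (f ^^ j) ` C = {}" if ij: "i < j" "j < n" for i j
  proof -
    \<comment> \<open>Injectivity of \<open>f ^^ i\<close> reduces the intersection to that of
      \<open>C\<close> with an earlier iterate, empty by the choice of \<open>n\<close>.\<close>
    have "(f ^^ j) ` C = (f ^^ i) ` (f ^^ (j - i)) ` C"
      unfolding image_comp funpow_add[symmetric] using ij by simp
    moreover have "(f ^^ (j - i)) ` C \<subseteq> topspace X"
      using openin_subset[OF op] .
    ultimately have "(f ^^ i) ` C \<inter> (f ^^ j) ` C = (f ^^ i) ` (C \<inter> (f ^^ (j - i)) ` C)"
      using inj_on_image_Int[OF inj CX] by simp
    moreover have "C \<inter> (f ^^ (j - i)) ` C = {}"
    proof -
      have "\<not> P (j - i)" "j - i \<ge> 1"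
        using n(2)[of "j - i"] ij by simp_all
      then show "C \<inter> (f ^^ (j - i)) ` C = {}"
        unfolding P_def by blast
    qed
    ultimately show ?thesis by simp
  qed
  have "(\<Union>i<n. (f ^^ i) ` C) = topspace X"
  proof (rule closed_forward_invariant)
    show "closedin X (\<Union>i<n. (f ^^ i) ` C)"
      by (rule closedin_Union) (auto simp: clo)
    show "(\<Union>i<n. (f ^^ i) ` C) \<noteq> {}"
      using C(4) n1 by (auto intro!: exI[of _ 0])
    show "f ` (\<Union>i<n. (f ^^ i) ` C) \<subseteq> (\<Union>i<n. (f ^^ i) ` C)"
    proof (rule image_subsetI)
      fix z assume "z \<in> (\<Union>i<n. (f ^^ i) ` C)"
      then obtain i y where iy: "i \<in> {..<n}" "y \<in> C" and z: "z = (f ^^ i) y"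
        by auto
      have "f ((f ^^ i) y) \<in> (\<Union>i<n. (f ^^ i) ` C)"
      proof (cases "Suc i < n")
        case True
        then show ?thesis
          using iy(2) by (intro UN_I[of "Suc i"]) auto
      next
        case False
        then have "n = Suc i"
          using iy(1) by simp
        then have "f ((f ^^ i) y) \<in> (f ^^ n) ` C"
          using iy(2) by auto
        then have "f ((f ^^ i) y) \<in> (f ^^ 0) ` C"
          using return by simp
        then show ?thesis
          using n1 by (intro UN_I[of 0]) auto
      qed
      then show "f z \<in> (\<Union>i<n. (f ^^ i) ` C)"
        by (simp only: z)
    qed
  qed
  moreover have "(f ^^ i) ` C \<inter> (f ^^ j) ` C = {}" if "i < n" "j < n" "i \<noteq> j" for i j
    using disj[of i j] disj[of j i] that by (metis Int_commute linorder_neqE_nat)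
  ultimately show ?thesis
    using that[of n] n1 return by simp
qed

text \<open>An orbit starting in \<open>C\<close> is in \<open>C\<close> only at multiples of
  \<open>n\<close>, so minimality of \<open>f\<close> passes to the return map.\<close>

lemma return_map_hits:
  assumes ret: "(f ^^ n) ` C = C" and CX: "C \<subseteq> topspace X" and n: "n > 0"
    and disj: "\<And>i j. i < n \<Longrightarrow> j < n \<Longrightarrow> i \<noteq> j \<Longrightarrow> (f ^^ i) ` C \<inter> (f ^^ j) ` C = {}"
    and x: "x \<in> C" and V: "openin X V" "V \<noteq> {}" "V \<subseteq> C"
  obtains m where "((f ^^ n) ^^ m) x \<in> V"
proof -
  have ret_m: "((f ^^ n) ^^ m) x \<in> C" for m
    by (induction m) (use x ret in auto)
  obtain l where l: "(f ^^ l) x \<in> V"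
    using hits[OF subsetD[OF CX x] V(1,2)] by blast
  have split: "(f ^^ l) x = (f ^^ (l mod n)) (((f ^^ n) ^^ (l div n)) x)"
    unfolding funpow_mult comp_apply[symmetric, of "f ^^ _"] funpow_add[symmetric] by simp
  have "l mod n = 0"
  proof (rule ccontr)
    assume "l mod n \<noteq> 0"
    then have "(f ^^ (l mod n)) ` C \<inter> (f ^^ 0) ` C = {}"
      using n by (intro disj) auto
    moreover have "(f ^^ l) x \<in> (f ^^ (l mod n)) ` C"
      unfolding split using ret_m by (rule imageI)
    moreover have "(f ^^ l) x \<in> (f ^^ 0) ` C"
      using l V(3) by auto
    ultimately show False by blast
  qed
  then show ?thesis
    using that[of "l div n"] l split by simp
qed

lemma circle_decomposition:
  "\<exists>(n::nat) (C :: nat \<Rightarrow> 'a set).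
     n > 0 \<and>
     is_disjoint_sum X C {..<n} \<and>
     (\<forall>i<n. is_circle (subtopology X (C i))) \<and>
     (\<forall>i<n. f ` C i = C (Suc i mod n)) \<and>
     (\<exists>\<alpha>::real. \<alpha> \<notin> \<rat> \<and>
        (\<forall>i<n. topologically_conjugate (subtopology X (C i)) (f ^^ n) unit_circle (rotation \<alpha>)))"
proof -
  obtain C \<psi> where C: "openin X C" "closedin X C" "connectedin X C"
    and \<psi>: "homeomorphic_map unit_circle (subtopology X C) \<psi>"
    using clopen_circle by blast
  have CX: "C \<subseteq> topspace X"
    using openin_subset[OF C(1)] .
  then have topC: "topspace (subtopology X C) = C"
    by auto
  have \<psi>_img: "\<psi> ` sphere 0 1 = C"
    using homeomorphic_imp_surjective_map[OF \<psi>] topC by simp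
  have "(1::complex) \<in> sphere 0 1"
    by simp
  then have "C \<noteq> {}"
    using \<psi>_img by blast
  then obtain n where n: "n > 0" "(f ^^ n) ` C = C" "(\<Union>i<n. (f ^^ i) ` C) = topspace X"
    "\<And>i j. i < n \<Longrightarrow> j < n \<Longrightarrow> i \<noteq> j \<Longrightarrow> (f ^^ i) ` C \<inter> (f ^^ j) ` C = {}"
    using circle_cycle[OF C] by blast
  obtain \<phi> where maps: "homeomorphic_maps unit_circle (subtopology X C) \<psi> \<phi>"
    using \<psi> by (auto simp: homeomorphic_map_maps)
  then have \<phi>: "homeomorphic_map (subtopology X C) unit_circle \<phi>"
    by (metis homeomorphic_map_maps homeomorphic_maps_sym)
  have \<phi>\<psi>: "\<phi> (\<psi> z) = z" if "z \<in> sphere 0 1" for z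
    using maps that by (simp add: homeomorphic_maps_def)
  have \<psi>\<phi>: "\<psi> (\<phi> x) = x" if "x \<in> C" for x
    using maps that topC by (simp add: homeomorphic_maps_def)
  have \<phi>_in: "\<phi> x \<in> sphere 0 1" if "x \<in> C" for x
    using homeomorphic_imp_surjective_map[OF \<phi>] topC that by auto
  have \<psi>_in: "\<psi> z \<in> C" if "z \<in> sphere 0 1" for z
    using \<psi>_img that by blast
  \<comment> \<open>The return map of \<open>C\<close>, carried to the unit circle.\<close>
  define h where "h z = \<phi> ((f ^^ n) (\<psi> z))" for z
  have sub_homeo: "homeomorphic_map (subtopology X S) (subtopology X T) (f ^^ m)"
    if "(f ^^ m) ` S = T" "S \<subseteq> topspace X" "T \<subseteq> topspace X" for m S T
    by (rule homeomorphic_map_subtopologies[OF homeo_funpow]) (use that in \<open>simp add: Int_absorb1\<close>)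
  have h_homeo: "homeomorphic_map unit_circle unit_circle h"
  proof -
    have "homeomorphic_map unit_circle unit_circle (\<phi> \<circ> ((f ^^ n) \<circ> \<psi>))"
      by (rule homeomorphic_map_compose[OF homeomorphic_map_compose[OF \<psi> sub_homeo[OF n(2) CX CX]] \<phi>])
    then show ?thesis
      by (simp add: h_def[abs_def] o_def)
  qed
  have h_pow: "(h ^^ m) (\<phi> x) = \<phi> (((f ^^ n) ^^ m) x) \<and> ((f ^^ n) ^^ m) x \<in> C" if "x \<in> C" for x m
  proof (induction m)
    case (Suc m)
    then have "(f ^^ n) (((f ^^ n) ^^ m) x) \<in> C"
      using n(2) by blast
    then show ?case
      using Suc by (simp add: h_def \<psi>\<phi>)
  qed (use that in auto)
  have h_in: "h ` sphere 0 1 = sphere 0 1"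
    using homeomorphic_imp_surjective_map[OF h_homeo] by simp
  have h_hits: "\<exists>m. (h ^^ m) z \<in> U" if z: "z \<in> sphere 0 1" and U: "openin unit_circle U" "U \<noteq> {}" for z U
  proof -
    have US: "U \<subseteq> sphere 0 1"
      using openin_subset[OF U(1)] by simp
    have "openin (subtopology X C) (\<psi> ` U)"
      using homeomorphic_imp_open_map[OF \<psi>] U(1) by (simp add: open_map_def)
    then have "openin X (\<psi> ` U)"
      using C(1) openin_trans_full by blast
    moreover have "\<psi> ` U \<subseteq> C"
      using US \<psi>_in by blast
    ultimately obtain m where "((f ^^ n) ^^ m) (\<psi> z) \<in> \<psi> ` U"
      using return_map_hits[OF n(2) CX n(1) n(4) \<psi>_in[OF z]] U(2) by (metis image_is_empty)
    then obtain u where u: "u \<in> U" "((f ^^ n) ^^ m) (\<psi> z) = \<psi> u"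
      by auto
    have "(h ^^ m) (\<phi> (\<psi> z)) = \<phi> (\<psi> u)"
      using h_pow[OF \<psi>_in[OF z], of m] u(2) by simp
    then have "(h ^^ m) z = u"
      using \<phi>\<psi>[OF z] \<phi>\<psi>[OF subsetD[OF US u(1)]] by simp
    then show ?thesis
      using u(1) by blast
  qed
  obtain \<alpha> \<Psi> where \<alpha>: "\<alpha> \<notin> \<rat>" and \<Psi>: "homeomorphic_map unit_circle unit_circle \<Psi>"
    and conj: "\<And>z. z \<in> sphere 0 1 \<Longrightarrow> \<Psi> (h z) = rotation \<alpha> (\<Psi> z)"
  proof (rule minimal_circle_homeo_conjugate_rotation[of h])
    show "continuous_on (sphere 0 1) h"
      using homeomorphic_imp_continuous_map[OF h_homeo] by simp
    show "inj_on h (sphere 0 1)"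
      using homeomorphic_imp_injective_map[OF h_homeo] by simp
  qed (use h_in h_hits in auto)
  define D where "D i = (f ^^ i) ` C" for i
  have D_open: "openin X (D i)" for i
    unfolding D_def using homeomorphic_imp_open_map[OF homeo_funpow[of i]] C(1) by (simp add: open_map_def)
  have DX: "D i \<subseteq> topspace X" for i
    using openin_subset[OF D_open] .
  have D_image: "(f ^^ j) ` D i = D (j + i)" for i j
    by (simp add: D_def image_image funpow_add)
  have Dn: "D n = D 0"
    using n(2) by (simp add: D_def)
  have D0: "D 0 = C"
    by (simp add: D_def)
  \<comment> \<open>Every piece is moved to \<open>C\<close> by \<open>f ^^ (n - i)\<close>, which
    commutes with \<open>f ^^ n\<close>; so one rotation serves for all pieces.\<close>
  define g where "g i = \<Psi> \<circ> (\<phi> \<circ> (f ^^ (n - i)))" for i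
  have g: "homeomorphic_map (subtopology X (D i)) unit_circle (g i)" if "i < n" for i
  proof -
    have "(f ^^ (n - i)) ` D i = C"
      using D_image[of "n - i" i] that Dn D0 by simp
    then show ?thesis
      unfolding g_def
      by (intro homeomorphic_map_compose[OF homeomorphic_map_compose[OF sub_homeo[OF _ DX CX] \<phi>] \<Psi>])
  qed
  have g_conj: "g i ((f ^^ n) x) = rotation \<alpha> (g i x)" if i: "i < n" and x: "x \<in> D i" for i x
  proof -
    define y where "y = (f ^^ (n - i)) x"
    have "y \<in> D (n - i + i)"
      unfolding y_def D_image[symmetric] using x by (rule imageI)
    then have y: "y \<in> C"
      using i Dn D0 by simp
    have "(f ^^ (n - i)) ((f ^^ n) x) = (f ^^ n) y"
      unfolding y_def by (metis add.commute comp_apply funpow_add)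
    then have "g i ((f ^^ n) x) = \<Psi> (\<phi> ((f ^^ n) y))"
      by (simp add: g_def)
    also have "\<dots> = \<Psi> (h (\<phi> y))"
      by (simp add: h_def \<psi>\<phi>[OF y])
    also have "\<dots> = rotation \<alpha> (\<Psi> (\<phi> y))"
      by (rule conj[OF \<phi>_in[OF y]])
    finally show ?thesis
      by (simp add: g_def y_def)
  qed
  have Dn_image: "(f ^^ n) ` D i = D i" for i
    unfolding D_image using D_image[of i n] D_image[of i 0] Dn by (simp add: add.commute)
  have rot: "continuous_map unit_circle unit_circle (rotation \<alpha>)"
    by (auto simp: rotation_def[abs_def] norm_mult intro!: continuous_intros)
  show ?thesis
  proof (intro exI conjI allI impI)
    show "n > 0"
      by (rule n(1))
    show "is_disjoint_sum X D {..<n}"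
      by (rule is_disjoint_sum_clopen) (use D_open n(3,4) in \<open>auto simp: D_def\<close>)
    show "is_circle (subtopology X (D i))" if "i < n" for i
      unfolding is_circle_def using g[OF that] homeomorphic_map_imp_homeomorphic_space by blast
    show "f ` D i = D (Suc i mod n)" if "i < n" for i
    proof -
      have "f ` D i = D (Suc i)"
        using D_image[of 1 i] by simp
      then show ?thesis
        using that Dn by (cases "Suc i = n") auto
    qed
    show "\<alpha> \<notin> \<rat>"
      by (rule \<alpha>)
    show "topologically_conjugate (subtopology X (D i)) (f ^^ n) unit_circle (rotation \<alpha>)" if i: "i < n" for i
      unfolding topologically_conjugate_def
    proof (intro conjI exI ballI)
      show "continuous_map (subtopology X (D i)) (subtopology X (D i)) (f ^^ n)"
        using homeomorphic_imp_continuous_map[OF sub_homeo[OF Dn_image DX DX]] .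
      show "g i ((f ^^ n) x) = rotation \<alpha> (g i x)" if "x \<in> topspace (subtopology X (D i))" for x
        using g_conj[OF i] that by simp
    qed (use rot g[OF i] in auto)
  qed
qed

end

text \<open>A ball inside the parameter interval is homeomorphic to the line, which gives a chart
  defined on all reals.\<close>

lemma free_interval_chart:
  assumes "free_interval X J"
  obtains e where "continuous_map euclideanreal X e" "open_map euclideanreal X e" "inj e"
proof -
  obtain I :: "real set" where J: "openin X J" and I: "open I" "I \<noteq> {}"
    and "subtopology X J homeomorphic_space top_of_set I"
    using assms unfolding free_interval_def by blast
  then obtain \<phi> where \<phi>: "homeomorphic_map (top_of_set I) (subtopology X J) \<phi>"
    by (metis homeomorphic_space homeomorphic_space_sym)
  obtain c r where r: "r > 0" "ball c r \<subseteq> I"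
    using I open_contains_ball by blast
  have "(UNIV :: real set) homeomorphic ball c r"
    using homeomorphic_ball_UNIV[OF r(1), of c] homeomorphic_sym by blast
  then obtain \<theta> \<theta>' where "homeomorphism (UNIV :: real set) (ball c r) \<theta> \<theta>'"
    unfolding homeomorphic_def by blast
  then have \<theta>: "continuous_on UNIV \<theta>" "\<theta> ` UNIV = ball c r" "inj \<theta>"
    unfolding homeomorphism_def by (auto intro: inj_on_inverseI)
  have \<theta>I: "\<theta> t \<in> I" for t
    using \<theta>(2) r(2) by blast
  have "continuous_map euclideanreal (top_of_set I) \<theta>"
    using \<theta>(1) \<theta>I by (simp add: continuous_map_in_subtopology)
  from continuous_map_compose[OF this homeomorphic_imp_continuous_map[OF \<phi>]]
  have cont: "continuous_map euclideanreal X (\<phi> \<circ> \<theta>)"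
    by (rule continuous_map_into_fulltopology)
  have open_m: "open_map euclideanreal X (\<phi> \<circ> \<theta>)"
    unfolding open_map_def
  proof (intro allI impI)
    fix U :: "real set" assume "openin euclideanreal U"
    then have "open U"
      by (simp only: open_openin)
    then have "open (\<theta> ` U)"
      by (intro invariance_of_domain continuous_on_subset[OF \<theta>(1)] inj_on_subset[OF \<theta>(3)]) auto
    then have "openin (top_of_set I) (\<theta> ` U)"
      using \<theta>I by (intro open_subset) auto
    then have "openin (subtopology X J) (\<phi> ` \<theta> ` U)"
      using homeomorphic_imp_open_map[OF \<phi>] unfolding open_map_def by blast
    then have "openin X (\<phi> ` \<theta> ` U)"
      using J openin_trans_full by blast
    then show "openin X ((\<phi> \<circ> \<theta>) ` U)"
      by (simp only: image_comp)
  qed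
  have "inj_on \<phi> (range \<theta>)"
    using homeomorphic_imp_injective_map[OF \<phi>] r(2) unfolding \<theta>(2)
    by (simp add: inj_on_subset)
  then have "inj (\<phi> \<circ> \<theta>)"
    by (rule comp_inj_on[OF \<theta>(3)])
  with cont open_m show ?thesis
    by (rule that)
qed

theorem theoremA:
  fixes X :: "'a topology" and J :: "'a set" and f :: "'a \<Rightarrow> 'a"
  assumes "compact_space X"
    and "metrizable_space X"
    and "free_interval X J"
    and "minimal_map X f"
  shows "\<exists>(n::nat) (C :: nat \<Rightarrow> 'a set).
           n > 0 \<and>
           is_disjoint_sum X C {..<n} \<and>
           (\<forall>i<n. is_circle (subtopology X (C i))) \<and>
           (\<forall>i<n. f ` C i = C (Suc i mod n)) \<and>
           (\<exists>\<alpha>::real. \<alpha> \<notin> \<rat> \<and>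
              (\<forall>i<n. topologically_conjugate (subtopology X (C i)) (f ^^ n)
                        unit_circle (rotation \<alpha>)))"
proof -
  obtain e where e: "continuous_map euclideanreal X e" "open_map euclideanreal X e" "inj e"
    using free_interval_chart[OF assms(3)] by blast
  have "e 0 \<in> topspace X"
    using e(1) by (auto simp: continuous_map_def)
  then interpret minimal_system_chart X f e
    using assms e metrizable_imp_Hausdorff_space by unfold_locales auto
  show ?thesis
    by (rule circle_decomposition)
qed

end
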